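(* Let $(X,\mathcal{C}_0,\mathcal{F},\tau)$ be a measurable locally convex space, $D$ a convex subset of $X$, and $\mu$ a probability measure on $(X,\mathcal{F})$ carried by $D$. Let $(\mu_n)_{n\ge 1}$ be the Cramér sequence associated with $\mu$ and $s$ its entropy. If $\mu$ is convex-tight on $D$, then: (1) for every $C\in\mathcal{F}$ such that $C\cap D$ is convex, $$\limsup_{n\to\infty}\frac1n\log\mu_n(C)\le\sup_{\overline{C}}s ;$$ (2) $\overline{\mathrm{dom}(s)}=\mathrm{cosupp}(\mu)$.
   Context: **Measurable locally convex space.** Let $X$ be a real vector space. For a convex set $C\subset X$ containing $0$, its gauge is $M_C(x)=\inf\{t\ge0: x\in tC\}\in[0,+\infty]$. $C$ is an internal convex set if $M_C$ is finite everywhere and $C=\{x\in X: M_C(x)<1\}$. For such $C$, $\tau_C$ denotes the (not necessarily Hausdorff) locally convex topology on $X$ generated by the neighbourhoods $tC$, $t\in\mathbb{R}\setminus\{0\}$, of $0$. A measurable locally convex space is a quadruple $(X,\mathcal{C}_0,\mathcal{F},\tau)$ where $\mathcal{C}_0$ is a family of convex subsets of $X$ such that: (i) every $C\in\mathcal{C}_0$ is an internal convex set, symmetric ($C=-C$), and $\tau_C$ is separable; (ii) $\mathcal{C}_0$ is stable under finite intersections and under dilations $C\mapsto tC$, $t\ne0$; (iii) the intersection of all elements of $\mathcal{C}_0$ is $\{0\}$. Then $\tau$ is the Hausdorff locally convex topology having $\mathcal{C}_0$ as a fundamental system of neighbourhoods of $0$; $\mathcal{C}_x=\{x+C: C\in\mathcal{C}_0\}$;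 and $\mathcal{F}=\sigma\big(\bigcup_{x\in X}\mathcal{C}_x\big)$. Topological notions refer to $\tau$. Vector addition $X^2\to X$ is $\mathcal{F}^{\otimes2}$-$\mathcal{F}$ measurable. **Cramér sequence, entropy.** Given a probability $\mu$ on $\mathcal{F}$, let $(X_n)_{n\ge1}$ be i.i.d. with law $\mu$, $\overline{X}_n=\frac1n\sum_{k=1}^nX_k$, and $\mu_n$ the law of $\overline{X}_n$; $(\mu_n)_{n\ge1}$ is the Cramér sequence associated with $\mu$. Its entropy is $s:X\to[-\infty,0]$, $s(x)=\inf_{C\in\mathcal{C}_x}\liminf_{n\to\infty}\frac1n\log\mu_n(C)$. Conventions: $\log0=-\infty$, $\sup\emptyset=-\infty$. **Carried, convex-tight.** $\mu$ is carried by $D\subset X$ if for all $A,B\in\mathcal{F}$, $A\cap D=B\cap D$ implies $\mu(A)=\mu(B)$. $\mu$ is convex-tight on $D$ if there is a sequence $(K_m)_{m\ge1}$ in $\mathcal{F}$ such that each $K_m\cap D$ is convex and relatively compact (contained in a compact set), and $\lim_m\mu(K_m)=1$. **Other notation.** $\mathrm{dom}(s)=\{x\in X: s(x)\in\mathbb{R}\}$; $\mathrm{supp}(\mu)=\{x\in X:\forall C\in\mathcal{C}_x,\ \mu(C)>0\}$; $\mathrm{cosupp}(\mu)$ is the closed convex hull of $\mathrm{supp}(\mu)$. *)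

theory Defs
  imports "HOL-Probability.Probability"
begin

section \<open>Measurable locally convex spaces\<close>

definition gauge_of :: "'a::real_vector set \<Rightarrow> 'a \<Rightarrow> ereal" where
  "gauge_of C x = Inf (ereal ` {t. 0 \<le> t \<and> x \<in> (\<lambda>y. t *\<^sub>R y) ` C})"

definition internal_convex :: "'a::real_vector set \<Rightarrow> bool" where
  "internal_convex C \<longleftrightarrow>
     convex C \<and> 0 \<in> C \<and> (\<forall>x. gauge_of C x < \<infinity>) \<and> C = {x. gauge_of C x < 1}"

definition translates :: "'a::real_vector set set \<Rightarrow> 'a \<Rightarrow> 'a set set" where
  "translates \<C> x = (\<lambda>C. (\<lambda>y. x + y) ` C) ` \<C>"

text \<open>For an internal convex set \<open>C\<close> every set \<open>x + t C\<close> with \<open>t \<noteq> 0\<close> is open in the locally convex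
  topology having the dilations \<open>t C\<close> as neighbourhoods of \<open>0\<close>, so these sets form a subbasis
  of that topology.\<close>

definition gauge_topology :: "'a::real_vector set \<Rightarrow> 'a topology" where
  "gauge_topology C =
     topology_generated_by (\<Union>x. translates {(\<lambda>y. t *\<^sub>R y) ` C | t. t \<noteq> 0} x)"

text \<open>Assumption \<open>nonempty\<close> is part of \<open>\<C>\<^sub>0\<close> being a fundamental system of neighbourhoods of \<open>0\<close>.
  Assumption \<open>openin_iff\<close> says that \<open>\<tau>\<close> is the translation invariant topology with this fundamental
  system; it is Hausdorff and locally convex by the other assumptions.\<close>

locale measurable_lcs =
  fixes \<C>\<^sub>0 :: "'a::real_vector set set" and \<F> :: "'a set set" and \<tau> :: "'a topology"
  assumes nonempty: "\<C>\<^sub>0 \<noteq> {}"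
    and internal: "C \<in> \<C>\<^sub>0 \<Longrightarrow> internal_convex C"
    and symmetric: "C \<in> \<C>\<^sub>0 \<Longrightarrow> uminus ` C = C"
    and separable: "C \<in> \<C>\<^sub>0 \<Longrightarrow> separable_space (gauge_topology C)"
    and inter: "C \<in> \<C>\<^sub>0 \<Longrightarrow> C' \<in> \<C>\<^sub>0 \<Longrightarrow> C \<inter> C' \<in> \<C>\<^sub>0"
    and dilation: "C \<in> \<C>\<^sub>0 \<Longrightarrow> t \<noteq> 0 \<Longrightarrow> (\<lambda>y. t *\<^sub>R y) ` C \<in> \<C>\<^sub>0"
    and Inter: "\<Inter>\<C>\<^sub>0 = {0}"
    and sigma_eq: "\<F> = sigma_sets UNIV (\<Union>x. translates \<C>\<^sub>0 x)"
    and openin_iff: "openin \<tau> U \<longleftrightarrow> (\<forall>x\<in>U. \<exists>V\<in>translates \<C>\<^sub>0 x. V \<subseteq> U)"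


section \<open>Cramer sequences and entropy\<close>

definition iid_sequence :: "'w measure \<Rightarrow> 'a measure \<Rightarrow> (nat \<Rightarrow> 'w \<Rightarrow> 'a) \<Rightarrow> bool" where
  "iid_sequence M \<mu> X \<longleftrightarrow>
     prob_space M \<and> prob_space.indep_vars M (\<lambda>_. \<mu>) X {1..} \<and> (\<forall>n\<ge>1. distr M \<mu> (X n) = \<mu>)"

text \<open>In \<open>cramer_sequence\<close>, \<open>\<mu>\<close> only supplies the \<open>\<sigma>\<close>-algebra on the target space.\<close>

definition cramer_sequence ::
    "'w measure \<Rightarrow> 'a::real_vector measure \<Rightarrow> (nat \<Rightarrow> 'w \<Rightarrow> 'a) \<Rightarrow> nat \<Rightarrow> 'a measure" where
  "cramer_sequence M \<mu> X n = distr M \<mu> (\<lambda>\<omega>. (1 / real n) *\<^sub>R (\<Sum>k=1..n. X k \<omega>))"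

definition ext_ln :: "real \<Rightarrow> ereal" where
  "ext_ln p = (if p \<le> 0 then -\<infinity> else ereal (ln p))"

definition log_rate :: "(nat \<Rightarrow> 'a measure) \<Rightarrow> 'a set \<Rightarrow> nat \<Rightarrow> ereal" where
  "log_rate \<nu> C n = ereal (1 / real n) * ext_ln (measure (\<nu> n) C)"

definition entropy :: "'a::real_vector set set \<Rightarrow> (nat \<Rightarrow> 'a measure) \<Rightarrow> 'a \<Rightarrow> ereal" where
  "entropy \<C>\<^sub>0 \<nu> x = (INF C\<in>translates \<C>\<^sub>0 x. liminf (log_rate \<nu> C))"

definition eff_dom :: "('a \<Rightarrow> ereal) \<Rightarrow> 'a set" where
  "eff_dom s = {x. \<bar>s x\<bar> \<noteq> \<infinity>}"


section \<open>Carrier, convex-tightness and support\<close>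

definition carried_by :: "'a measure \<Rightarrow> 'a set \<Rightarrow> bool" where
  "carried_by \<mu> D \<longleftrightarrow>
     (\<forall>A\<in>sets \<mu>. \<forall>B\<in>sets \<mu>. A \<inter> D = B \<inter> D \<longrightarrow> measure \<mu> A = measure \<mu> B)"

definition convex_tight_on :: "'a::real_vector topology \<Rightarrow> 'a measure \<Rightarrow> 'a set \<Rightarrow> bool" where
  "convex_tight_on \<tau> \<mu> D \<longleftrightarrow>
     (\<exists>K :: nat \<Rightarrow> 'a set.
        (\<forall>m. K m \<in> sets \<mu> \<and> convex (K m \<inter> D) \<and> (\<exists>L. compactin \<tau> L \<and> K m \<inter> D \<subseteq> L)) \<and>
        (\<lambda>m. measure \<mu> (K m)) \<longlonglongrightarrow> 1)"

definition supp :: "'a::real_vector set set \<Rightarrow> 'a measure \<Rightarrow> 'a set" where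
  "supp \<C>\<^sub>0 \<mu> = {x. \<forall>C\<in>translates \<C>\<^sub>0 x. measure \<mu> C > 0}"

definition cosupp :: "'a::real_vector set set \<Rightarrow> 'a topology \<Rightarrow> 'a measure \<Rightarrow> 'a set" where
  "cosupp \<C>\<^sub>0 \<tau> \<mu> = (\<lambda>S. convex S \<and> closedin \<tau> S) hull supp \<C>\<^sub>0 \<mu>"

end

(* Writing nu_n for the law of the n-th mean, nu_(m+n) is the image of nu_m (x) nu_n under
   (x, y) |-> (m x + n y) / (m + n); Fubini with sections shows that every nu_n is carried by D and that
   nu_m(A) nu_n(B) <= nu_(m+n)(E) whenever this map sends (A Int D) x (B Int D) into E.  Hence nu_n(C)
   is supermultiplicative when C Int D is convex.

   For a basic neighbourhood C this gives nu_n(C) <= exp(n l) for all n, where l is the liminf in the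
   entropy.  If s < a on the closure of C and C Int D is relatively compact and convex, finitely many
   neighbourhoods of rate < a cover it, so nu_N(C) <= M exp(N a) for all N; with N = k n,
   supermultiplicativity and k -> infinity the factor M disappears.  A general C is approximated by
   C Int K_m, because nu_n(K_m) >= mu(K_m)^n -> 1 for fixed n.

   A point outside cosupp(mu) is separated from it by an open convex neighbourhood U of cosupp(mu); by
   tightness mu(U) = 1, so nu_n(U) = 1 and the entropy is -infinity there.  Conversely dom(s) is convex,
   and by the upper bound it meets every neighbourhood of every point of the support. *)

theory Submission
  imports Defs
begin

section \<open>Seminorms\<close>

definition seminorm :: "('a::real_vector \<Rightarrow> real) \<Rightarrow> bool" where
  "seminorm p \<longleftrightarrow> (\<forall>x y. p (x + y) \<le> p x + p y) \<and> (\<forall>c x. p (c *\<^sub>R x) = \<bar>c\<bar> * p x)"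

definition sball :: "('a::real_vector \<Rightarrow> real) \<Rightarrow> 'a \<Rightarrow> real \<Rightarrow> 'a set" where
  "sball p x r = {y. p (y - x) < r}"

lemma seminorm_add: "seminorm p \<Longrightarrow> p (x + y) \<le> p x + p y"
  and seminorm_scale: "seminorm p \<Longrightarrow> p (c *\<^sub>R x) = \<bar>c\<bar> * p x"
  unfolding seminorm_def by blast+

lemma seminorm_zero: "seminorm p \<Longrightarrow> p 0 = 0"
  using seminorm_scale[of p 0 0] by simp

lemma seminorm_uminus: "seminorm p \<Longrightarrow> p (- x) = p x"
  using seminorm_scale[of p "- 1" x] by simp

lemma seminorm_diff_commute: "seminorm p \<Longrightarrow> p (x - y) = p (y - x)"
  using seminorm_uminus[of p "x - y"] by simp

lemma seminorm_nonneg: "seminorm p \<Longrightarrow> 0 \<le> p x"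
  using seminorm_add[of p x "- x"] by (simp add: seminorm_zero seminorm_uminus)

lemma seminorm_triangle: "seminorm p \<Longrightarrow> p (x - z) \<le> p (x - y) + p (y - z)"
  using seminorm_add[of p "x - y" "y - z"] by simp

lemma seminorm_divide:
  assumes "seminorm p" "0 < r"
  shows "seminorm (\<lambda>x. p x / r)"
  unfolding seminorm_def
proof (intro conjI allI)
  show "p (x + y) / r \<le> p x / r + p y / r" for x y
    using seminorm_add[OF assms(1), of x y] assms(2) by (simp add: field_simps)
  show "p (c *\<^sub>R x) / r = \<bar>c\<bar> * (p x / r)" for c x
    using seminorm_scale[OF assms(1), of c x] by simp
qed

lemma sball_divide: "0 < r \<Longrightarrow> sball (\<lambda>x. p x / r) x 1 = sball p x r"
  by (auto simp: sball_def)

lemma centre_in_sball: "seminorm p \<Longrightarrow> 0 < r \<Longrightarrow> x \<in> sball p x r"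
  by (simp add: sball_def seminorm_zero)

lemma convex_sball:
  assumes "seminorm p"
  shows "convex (sball p z r)"
  unfolding convex_alt
proof (intro ballI allI impI)
  fix x y and u :: real
  assume xy: "x \<in> sball p z r" "y \<in> sball p z r" and u: "0 \<le> u \<and> u \<le> 1"
  have "(1 - u) *\<^sub>R x + u *\<^sub>R y - z = (1 - u) *\<^sub>R (x - z) + u *\<^sub>R (y - z)"
    by (simp add: algebra_simps)
  then have "p ((1 - u) *\<^sub>R x + u *\<^sub>R y - z) \<le> (1 - u) * p (x - z) + u * p (y - z)"
    using seminorm_add[OF assms, of "(1 - u) *\<^sub>R (x - z)" "u *\<^sub>R (y - z)"] u
    by (simp add: seminorm_scale[OF assms])
  also have "\<dots> < r"
  proof (cases "u = 0")
    case False
    then have "u * p (y - z) < u * r"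
      using xy u by (simp add: sball_def)
    moreover have "(1 - u) * p (x - z) \<le> (1 - u) * r"
      using xy u by (intro mult_left_mono) (auto simp: sball_def)
    ultimately show ?thesis by (simp add: algebra_simps)
  qed (use xy in \<open>simp add: sball_def\<close>)
  finally show "(1 - u) *\<^sub>R x + u *\<^sub>R y \<in> sball p z r"
    by (simp add: sball_def)
qed

text \<open>The seminorm is the Minkowski functional of \<open>C\<close>, with the infimum
  restricted to \<open>t > 0\<close> so that it is a real number. Convexity gives subadditivity,
  symmetry gives absolute homogeneity, and the equation \<open>C = {x. gauge_of C x < 1}\<close> is
  what makes \<open>C\<close> the open unit ball.\<close>

lemma internal_convex_sball:
  fixes C :: "'a::real_vector set"
  assumes C: "internal_convex C" and sym: "uminus ` C = C"
  shows "\<exists>p. seminorm p \<and> C = sball p 0 1"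
proof -
  define S where "S x = {t. 0 < t \<and> inverse t *\<^sub>R x \<in> C}" for x
  define p where "p x = Inf (S x)" for x
  have cvx: "convex C" and zero: "0 \<in> C" and fin: "gauge_of C x < \<infinity>" and C_eq: "C = {x. gauge_of C x < 1}" for x
    using C by (auto simp: internal_convex_def)
  \<comment> \<open>A witness \<open>t = 0\<close> of \<open>gauge_of\<close> forces
    \<open>x = 0\<close>, and then any small positive number serves, as \<open>0 \<in> C\<close>.
    The bound \<open>b = \<infinity>\<close> shows that \<open>S x\<close> is nonempty;
    \<open>b = 1\<close> is used for the points of \<open>C\<close>.\<close>
  have gauge: "\<exists>t\<in>S x. ereal t < b" if "gauge_of C x < b" "0 < b" for x b
  proof -
    obtain t where t: "0 \<le> t" "ereal t < b" "x \<in> (\<lambda>y. t *\<^sub>R y) ` C"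
      using \<open>gauge_of C x < b\<close> by (auto simp: gauge_of_def Inf_less_iff)
    show ?thesis
    proof (cases "t = 0")
      case True
      obtain s where s: "0 < s" "ereal s < b"
        using ereal_dense2[OF \<open>0 < b\<close>] by auto
      then show ?thesis using t True zero by (auto simp: S_def intro!: bexI[of _ s])
    next
      case False
      then have "t \<in> S x" using t by (auto simp: S_def)
      then show ?thesis using t by blast
    qed
  qed
  have ne: "S x \<noteq> {}" for x
    using gauge[OF fin[of x]] by auto
  have bdd: "bdd_below (S x)" for x
    by (rule bdd_belowI[of _ 0]) (auto simp: S_def)
  have lower: "p x \<le> t" if "t \<in> S x" for x t
    unfolding p_def using that bdd by (rule cInf_lower)
  have greatest: "a \<le> p x" if "\<And>t. t \<in> S x \<Longrightarrow> a \<le> t" for x a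
    unfolding p_def using ne that by (rule cInf_greatest)
  \<comment> \<open>The point \<open>inverse (s + t) *\<^sub>R (x + y)\<close> is the convex
    combination of \<open>inverse s *\<^sub>R x\<close> and \<open>inverse t *\<^sub>R y\<close>
    with weights proportional to \<open>s\<close> and \<open>t\<close>.\<close>
  have S_add: "s + t \<in> S (x + y)" if "s \<in> S x" "t \<in> S y" for s t x y
  proof -
    have st: "0 < s" "0 < t" "inverse s *\<^sub>R x \<in> C" "inverse t *\<^sub>R y \<in> C"
      using that by (auto simp: S_def)
    have "(s / (s + t)) *\<^sub>R (inverse s *\<^sub>R x) + (t / (s + t)) *\<^sub>R (inverse t *\<^sub>R y) \<in> C"
      using st by (intro convexD[OF cvx]) (auto simp flip: add_divide_distrib)
    moreover have "s / (s + t) * inverse s = inverse (s + t)" "t / (s + t) * inverse t = inverse (s + t)"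
      using st by (auto simp: divide_inverse)
    ultimately show ?thesis
      using st by (simp add: S_def scaleR_add_right)
  qed
  have add: "p (x + y) \<le> p x + p y" for x y
  proof -
    have "p (x + y) - p x \<le> p y"
    proof (rule greatest)
      fix t assume t: "t \<in> S y"
      have "p (x + y) - t \<le> p x"
      proof (rule greatest)
        fix s assume "s \<in> S x"
        from lower[OF S_add[OF this t]] show "p (x + y) - t \<le> s" by simp
      qed
      then show "p (x + y) - p x \<le> t" by simp
    qed
    then show ?thesis by simp
  qed
  have uminus_C: "- x \<in> C" if "x \<in> C" for x
    using sym that by auto
  have scale_le: "p (c *\<^sub>R x) \<le> \<bar>c\<bar> * p x" if c: "c \<noteq> 0" for c x
  proof -
    have "p (c *\<^sub>R x) / \<bar>c\<bar> \<le> p x"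
    proof (rule greatest)
      fix t assume t: "t \<in> S x"
      have "inverse (\<bar>c\<bar> * t) *\<^sub>R (c *\<^sub>R x) = (if c > 0 then inverse t *\<^sub>R x else - (inverse t *\<^sub>R x))"
        using c by (auto simp: field_simps)
      then have "\<bar>c\<bar> * t \<in> S (c *\<^sub>R x)"
        using t c uminus_C by (auto simp: S_def simp del: scaleR_scaleR)
      from lower[OF this] show "p (c *\<^sub>R x) / \<bar>c\<bar> \<le> t"
        using c by (simp add: field_simps)
    qed
    then show ?thesis using c by (simp add: field_simps)
  qed
  have p0: "p 0 = 0"
  proof (rule antisym)
    have "p 0 \<le> e" if "0 < e" for e
      using that zero by (intro lower) (auto simp: S_def)
    then show "p 0 \<le> 0" by (rule field_le_epsilon[of "p 0" 0, simplified])
    show "0 \<le> p 0" by (rule greatest) (auto simp: S_def)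
  qed
  have scale: "p (c *\<^sub>R x) = \<bar>c\<bar> * p x" for c x
  proof (cases "c = 0")
    case False
    have "p x \<le> \<bar>inverse c\<bar> * p (c *\<^sub>R x)"
      using scale_le[of "inverse c" "c *\<^sub>R x"] False by simp
    then have "\<bar>c\<bar> * p x \<le> p (c *\<^sub>R x)"
      using False by (simp add: field_simps)
    with scale_le[OF False, of x] show ?thesis by simp
  qed (simp add: p0)
  have "x \<in> C \<longleftrightarrow> p x < 1" for x
  proof
    assume "x \<in> C"
    then have "gauge_of C x < 1"
      using C_eq by blast
    from gauge[OF this] show "p x < 1"
      using lower by fastforce
  next
    assume "p x < 1"
    then obtain t where t: "t \<in> S x" "t < 1"
      unfolding p_def using cInf_less_iff[OF ne bdd] by blast
    then have "t *\<^sub>R (inverse t *\<^sub>R x) + (1 - t) *\<^sub>R 0 \<in> C"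
      by (intro convexD[OF cvx] zero) (auto simp: S_def)
    then show "x \<in> C" using t by (simp add: S_def)
  qed
  then show ?thesis
    using add scale by (intro exI[of _ p]) (auto simp: seminorm_def sball_def)
qed

section \<open>Topology and measurability in terms of seminorms\<close>

context measurable_lcs
begin

text \<open>The functional counterpart of \<open>\<C>\<^sub>0\<close>: by
  \<open>internal_convex_sball\<close> the unit balls of these seminorms are exactly its members,
  and the rest of the proof works with one seminorm at a time.\<close>

definition seminorms :: "('a \<Rightarrow> real) set" where
  "seminorms = {p. seminorm p \<and> sball p 0 1 \<in> \<C>\<^sub>0}"

lemma seminorm_if_seminorms: "p \<in> seminorms \<Longrightarrow> seminorm p"
  by (simp add: seminorms_def)

lemma seminorms_nonempty: "seminorms \<noteq> {}"
proof -
  obtain C where C: "C \<in> \<C>\<^sub>0" using nonempty by blast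
  then show ?thesis
    using internal_convex_sball[OF internal[OF C] symmetric[OF C]] by (auto simp: seminorms_def)
qed

lemma translate_sball: "(\<lambda>y. x + y) ` sball p 0 r = sball p x r"
proof -
  have "y \<in> (\<lambda>y. x + y) ` sball p 0 r" if "y \<in> sball p x r" for y
    using that by (intro image_eqI[of _ _ "y - x"]) (auto simp: sball_def)
  then show ?thesis by (auto simp: sball_def)
qed

lemma scale_sball:
  assumes "seminorm p" "t \<noteq> 0"
  shows "(\<lambda>y. t *\<^sub>R y) ` sball p 0 r = sball p 0 (\<bar>t\<bar> * r)"
proof -
  have "y \<in> (\<lambda>y. t *\<^sub>R y) ` sball p 0 r" if "y \<in> sball p 0 (\<bar>t\<bar> * r)" for y
    using that assms
    by (intro image_eqI[of _ _ "inverse t *\<^sub>R y"]) (auto simp: sball_def seminorm_scale field_simps)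
  then show ?thesis using assms by (auto simp: sball_def seminorm_scale)
qed

lemma translates_eq: "translates \<C>\<^sub>0 x = (\<lambda>p. sball p x 1) ` seminorms"
proof
  show "translates \<C>\<^sub>0 x \<subseteq> (\<lambda>p. sball p x 1) ` seminorms"
  proof
    fix V assume "V \<in> translates \<C>\<^sub>0 x"
    then obtain C where C: "C \<in> \<C>\<^sub>0" and V: "V = (\<lambda>y. x + y) ` C"
      by (auto simp: translates_def)
    obtain p where "seminorm p" "C = sball p 0 1"
      using internal_convex_sball[OF internal[OF C] symmetric[OF C]] by auto
    then show "V \<in> (\<lambda>p. sball p x 1) ` seminorms"
      using C V by (simp add: translate_sball seminorms_def)
  qed
  show "(\<lambda>p. sball p x 1) ` seminorms \<subseteq> translates \<C>\<^sub>0 x"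
  proof (rule image_subsetI)
    fix p assume "p \<in> seminorms"
    then show "sball p x 1 \<in> translates \<C>\<^sub>0 x"
      unfolding translates_def
      by (intro image_eqI[where x="sball p 0 1"]) (simp_all add: seminorms_def translate_sball)
  qed
qed

text \<open>Stability of \<open>\<C>\<^sub>0\<close> under dilations in functional form; it makes
  balls of every positive radius basic neighbourhoods.\<close>

lemma seminorms_divide:
  assumes "p \<in> seminorms" "0 < r"
  shows "(\<lambda>x. p x / r) \<in> seminorms"
proof -
  have "sball p 0 r = (\<lambda>y. r *\<^sub>R y) ` sball p 0 1"
    using assms by (simp add: scale_sball seminorm_if_seminorms)
  also have "\<dots> \<in> \<C>\<^sub>0"
    using assms by (intro dilation) (auto simp: seminorms_def)
  finally show ?thesis
    using assms by (simp add: seminorms_def sball_divide seminorm_divide)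
qed

lemma sball_in_translates: "p \<in> seminorms \<Longrightarrow> 0 < r \<Longrightarrow> sball p x r \<in> translates \<C>\<^sub>0 x"
  unfolding translates_eq
  by (rule image_eqI[where x="\<lambda>x. p x / r"]) (simp_all add: seminorms_divide sball_divide)

lemma sball_in_F: "p \<in> seminorms \<Longrightarrow> 0 < r \<Longrightarrow> sball p x r \<in> \<F>"
  unfolding sigma_eq by (rule sigma_sets.Basic) (use sball_in_translates in blast)

lemma F_eq_sball: "\<F> = sigma_sets UNIV {sball p x 1 |p x. p \<in> seminorms}"
proof -
  have "(\<Union>x. translates \<C>\<^sub>0 x) = {sball p x 1 |p x. p \<in> seminorms}"
    unfolding translates_eq by auto
  then show ?thesis using sigma_eq by simp
qed

lemma sigma_algebra_F: "sigma_algebra UNIV \<F>"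
  unfolding F_eq_sball by (rule sigma_algebra_sigma_sets) simp

lemma topspace_UNIV: "topspace \<tau> = UNIV"
proof -
  have "openin \<tau> UNIV"
    unfolding openin_iff translates_eq using seminorms_nonempty by auto
  then show ?thesis
    using openin_subset by auto
qed

lemma openin_sball:
  assumes p: "p \<in> seminorms"
  shows "openin \<tau> (sball p x r)"
  unfolding openin_iff
proof
  fix y assume y: "y \<in> sball p x r"
  show "\<exists>V\<in>translates \<C>\<^sub>0 y. V \<subseteq> sball p x r"
  proof (rule bexI)
    show "sball p y (r - p (y - x)) \<in> translates \<C>\<^sub>0 y"
      using y p by (intro sball_in_translates) (auto simp: sball_def)
    show "sball p y (r - p (y - x)) \<subseteq> sball p x r"
    proof
      fix z assume "z \<in> sball p y (r - p (y - x))"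
      then show "z \<in> sball p x r"
        using seminorm_triangle[OF seminorm_if_seminorms[OF p], of z x y] by (simp add: sball_def)
    qed
  qed
qed

lemma in_closure_iff: "x \<in> \<tau> closure_of S \<longleftrightarrow> (\<forall>p\<in>seminorms. sball p x 1 \<inter> S \<noteq> {})"
proof
  assume x: "x \<in> \<tau> closure_of S"
  show "\<forall>p\<in>seminorms. sball p x 1 \<inter> S \<noteq> {}"
  proof
    fix p assume p: "p \<in> seminorms"
    then have "x \<in> sball p x 1"
      by (simp add: centre_in_sball seminorm_if_seminorms)
    then show "sball p x 1 \<inter> S \<noteq> {}"
      using x openin_sball[OF p] unfolding in_closure_of by blast
  qed
next
  assume *: "\<forall>p\<in>seminorms. sball p x 1 \<inter> S \<noteq> {}"
  show "x \<in> \<tau> closure_of S"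
    unfolding in_closure_of
  proof (intro conjI allI impI)
    fix T assume T: "x \<in> T \<and> openin \<tau> T"
    then obtain p where p: "p \<in> seminorms" "sball p x 1 \<subseteq> T"
      unfolding openin_iff translates_eq by blast
    then show "\<exists>y. y \<in> S \<and> y \<in> T" using * by blast
  qed (simp add: topspace_UNIV)
qed

lemma convex_closure_of:
  assumes "convex S"
  shows "convex (\<tau> closure_of S)"
  unfolding convex_alt
proof (intro ballI allI impI)
  fix x y and u :: real
  assume xy: "x \<in> \<tau> closure_of S" "y \<in> \<tau> closure_of S" and u: "0 \<le> u \<and> u \<le> 1"
  show "(1 - u) *\<^sub>R x + u *\<^sub>R y \<in> \<tau> closure_of S"
    unfolding in_closure_iff
  proof
    fix p assume p: "p \<in> seminorms"
    then obtain x' y' where xy': "x' \<in> S" "x' \<in> sball p x 1" "y' \<in> S" "y' \<in> sball p y 1"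
      using xy unfolding in_closure_iff by blast
    have sn: "seminorm p" using p by (rule seminorm_if_seminorms)
    have "(1 - u) *\<^sub>R (x' - x) + u *\<^sub>R (y' - y) \<in> sball p 0 1"
      using xy' u by (intro convexD[OF convex_sball[OF sn]]) (auto simp: sball_def)
    then have "(1 - u) *\<^sub>R x' + u *\<^sub>R y' \<in> sball p ((1 - u) *\<^sub>R x + u *\<^sub>R y) 1"
      by (simp add: sball_def algebra_simps)
    moreover have "(1 - u) *\<^sub>R x' + u *\<^sub>R y' \<in> S"
      using xy' u assms by (auto simp: convex_alt)
    ultimately show "sball p ((1 - u) *\<^sub>R x + u *\<^sub>R y) 1 \<inter> S \<noteq> {}" by blast
  qed
qed

section \<open>Separability and membership in the sigma-algebra\<close>

lemma countable_dense:
  assumes p: "p \<in> seminorms"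
  obtains Q where "countable Q" "\<And>x r. 0 < r \<Longrightarrow> \<exists>q\<in>Q. p (x - q) < r"
proof -
  let ?T = "gauge_topology (sball p 0 1)"
  have sn: "seminorm p" using p by (rule seminorm_if_seminorms)
  have op: "openin ?T (sball p x r)" if "0 < r" for x r
  proof -
    have "sball p x r = (\<lambda>y. x + y) ` (\<lambda>y. r *\<^sub>R y) ` sball p 0 1"
      using that by (simp add: scale_sball[OF sn] translate_sball)
    then have "sball p x r \<in> translates {(\<lambda>y. t *\<^sub>R y) ` sball p 0 1 | t. t \<noteq> 0} x"
      unfolding translates_def by (rule image_eqI) (use that in blast)
    then have "sball p x r \<in> (\<Union>x. translates {(\<lambda>y. t *\<^sub>R y) ` sball p 0 1 | t. t \<noteq> 0} x)"
      by blast
    then show ?thesis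
      unfolding gauge_topology_def by (rule topology_generated_by_Basis)
  qed
  have top: "topspace ?T = UNIV"
    using op[THEN openin_subset, of 1] centre_in_sball[OF sn, of 1] by fastforce
  have "separable_space ?T"
    using p by (intro separable) (simp add: seminorms_def)
  then obtain Q where Q: "countable Q" "?T closure_of Q = UNIV"
    unfolding separable_space_def top by auto
  show ?thesis
  proof (rule that[OF Q(1)])
    fix x and r :: real assume r: "0 < r"
    have "x \<in> ?T closure_of Q" using Q by simp
    then have "\<exists>q. q \<in> Q \<and> q \<in> sball p x r"
      using op[OF r, of x] centre_in_sball[OF sn r, of x] unfolding in_closure_of by blast
    then show "\<exists>q\<in>Q. p (x - q) < r"
      by (auto simp: sball_def seminorm_diff_commute[OF sn])
  qed
qed

text \<open>Such a set is a countable union of balls with rational radii and centres in a dense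
  countable set. All balls in the hypothesis come from the same \<open>p\<close>, because
  separability is available for one seminorm at a time.\<close>

lemma sball_open_in_F:
  assumes p: "p \<in> seminorms" and U: "\<And>x. x \<in> U \<Longrightarrow> \<exists>r>0. sball p x r \<subseteq> U"
  shows "U \<in> \<F>"
proof -
  interpret F: sigma_algebra UNIV \<F> by (rule sigma_algebra_F)
  have sn: "seminorm p" using p by (rule seminorm_if_seminorms)
  obtain Q where Q: "countable Q" "\<And>x r. 0 < r \<Longrightarrow> \<exists>q\<in>Q. p (x - q) < r"
    using countable_dense[OF p] by blast
  define I where "I = {(q, r). q \<in> Q \<and> r \<in> \<rat> \<and> 0 < r \<and> sball p q r \<subseteq> U}"
  have "countable I"
    by (rule countable_subset[of _ "Q \<times> \<rat>"]) (auto simp: I_def Q countable_rat)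
  then have "(\<Union>(q, r)\<in>I. sball p q r) \<in> \<F>"
    by (intro F.countable_UN') (auto simp: I_def intro: sball_in_F[OF p])
  also have "(\<Union>(q, r)\<in>I. sball p q r) = U"
  proof
    show "U \<subseteq> (\<Union>(q, r)\<in>I. sball p q r)"
    proof
      fix x assume "x \<in> U"
      then obtain r where r: "0 < r" "sball p x r \<subseteq> U" using U by blast
      \<comment> \<open>A centre within \<open>s\<close> of \<open>x\<close> moves points of its
        \<open>s\<close>-ball at most \<open>2 * s < r\<close> away from \<open>x\<close>.\<close>
      then obtain s where s: "s \<in> \<rat>" "0 < s" "s < r / 2"
        using Rats_dense_in_real[of 0 "r / 2"] by auto
      obtain q where q: "q \<in> Q" "p (x - q) < s" using Q(2)[OF s(2)] by blast
      have "sball p q s \<subseteq> sball p x r"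
      proof
        fix y assume "y \<in> sball p q s"
        then show "y \<in> sball p x r"
          using seminorm_triangle[OF sn, of y x q] seminorm_diff_commute[OF sn, of x q] q s
          by (simp add: sball_def)
      qed
      then have "(q, s) \<in> I" using q s r by (auto simp: I_def)
      moreover have "x \<in> sball p q s" using q by (simp add: sball_def)
      ultimately show "x \<in> (\<Union>(q, r)\<in>I. sball p q r)" by blast
    qed
  qed (auto simp: I_def)
  finally show ?thesis .
qed

lemma measurable_into_F:
  assumes N: "sets N = \<F>" and f: "\<And>p x. p \<in> seminorms \<Longrightarrow> f -` sball p x 1 \<inter> space K \<in> sets K"
  shows "f \<in> measurable K N"
proof (rule measurable_sigma_sets[where \<Omega>=UNIV])
  show "sets N = sigma_sets UNIV {sball p x 1 |p x. p \<in> seminorms}"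
    using N F_eq_sball by simp
qed (use f in auto)

lemma space_if_sets_F: "sets N = \<F> \<Longrightarrow> space N = UNIV"
proof -
  assume N: "sets N = \<F>"
  have "UNIV \<in> sets N"
    unfolding N F_eq_sball by (rule sigma_sets_top)
  then show ?thesis using sets.sets_into_space by blast
qed

section \<open>Measurability of the vector operations\<close>

lemma measurable_scaleR:
  assumes N: "sets N = \<F>"
  shows "(\<lambda>x. c *\<^sub>R x) \<in> measurable N N"
proof (rule measurable_into_F[OF N])
  fix p x assume p: "p \<in> seminorms"
  then have sn: "seminorm p" by (rule seminorm_if_seminorms)
  have "(\<lambda>x. c *\<^sub>R x) -` sball p x 1 \<in> \<F>"
  proof (rule sball_open_in_F[OF p])
    fix y assume "y \<in> (\<lambda>x. c *\<^sub>R x) -` sball p x 1"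
    then have y: "p (c *\<^sub>R y - x) < 1" by (simp add: sball_def)
    \<comment> \<open>The summand 1 in the denominator covers \<open>c = 0\<close> and makes
      \<open>\<bar>c\<bar> * r\<close> strictly smaller than the slack in the numerator.\<close>
    define r where "r = (1 - p (c *\<^sub>R y - x)) / (\<bar>c\<bar> + 1)"
    have "sball p y r \<subseteq> (\<lambda>x. c *\<^sub>R x) -` sball p x 1"
    proof
      fix z assume "z \<in> sball p y r"
      then have "\<bar>c\<bar> * p (z - y) \<le> \<bar>c\<bar> * r"
        by (intro mult_left_mono) (auto simp: sball_def)
      also have "\<dots> < 1 - p (c *\<^sub>R y - x)"
        using y by (simp add: r_def field_simps)
      finally have "p (c *\<^sub>R z - c *\<^sub>R y) < 1 - p (c *\<^sub>R y - x)"
        by (simp add: seminorm_scale[OF sn] flip: scaleR_diff_right)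
      then show "z \<in> (\<lambda>x. c *\<^sub>R x) -` sball p x 1"
        using seminorm_triangle[OF sn, of "c *\<^sub>R z" x "c *\<^sub>R y"] by (simp add: sball_def)
    qed
    moreover have "0 < r" using y by (simp add: r_def)
    ultimately show "\<exists>r>0. sball p y r \<subseteq> (\<lambda>x. c *\<^sub>R x) -` sball p x 1" by blast
  qed
  then show "(\<lambda>x. c *\<^sub>R x) -` sball p x 1 \<inter> space N \<in> sets N"
    using N space_if_sets_F[OF N] by simp
qed

text \<open>The preimage of a ball is a countable union of measurable rectangles: \<open>x\<close>
  is approximated by some \<open>q\<close> in a dense set, \<open>y\<close> then lies near
  \<open>z - q\<close>, and the radii \<open>r\<close> and \<open>1 - r\<close> add up to 1.
  Rectangles keep the argument inside the product sigma-algebra.\<close>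

lemma measurable_add:
  assumes N: "sets N = \<F>"
  shows "(\<lambda>(x, y). x + y) \<in> measurable (N \<Otimes>\<^sub>M N) N"
proof (rule measurable_into_F[OF N])
  fix p z assume p: "p \<in> seminorms"
  then have sn: "seminorm p" by (rule seminorm_if_seminorms)
  obtain Q where Q: "countable Q" "\<And>x r. 0 < r \<Longrightarrow> \<exists>q\<in>Q. p (x - q) < r"
    using countable_dense[OF p] by blast
  define I where "I = Q \<times> {r \<in> \<rat>. 0 < r \<and> r < (1::real)}"
  have "countable I"
    unfolding I_def by (intro countable_SIGMA Q countable_subset[OF _ countable_rat]) auto
  then have "(\<Union>(q, r)\<in>I. sball p q r \<times> sball p (z - q) (1 - r)) \<in> sets (N \<Otimes>\<^sub>M N)"
    by (intro sets.countable_UN') (auto simp: I_def N intro!: pair_measureI sball_in_F[OF p])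
  also have "(\<Union>(q, r)\<in>I. sball p q r \<times> sball p (z - q) (1 - r))
      = (\<lambda>(x, y). x + y) -` sball p z 1 \<inter> space (N \<Otimes>\<^sub>M N)" (is "?L = ?R")
  proof
    show "?L \<subseteq> ?R"
    proof
      fix w assume "w \<in> ?L"
      then obtain q r x y where w: "w = (x, y)" "p (x - q) < r" "p (y - (z - q)) < 1 - r"
        by (auto simp: sball_def)
      have "(x - q) + (y - (z - q)) = x + y - z" by simp
      then have "p (x + y - z) < 1"
        using w seminorm_add[OF sn, of "x - q" "y - (z - q)"] by (simp only:)
      then show "w \<in> ?R"
        using w by (simp add: sball_def space_pair_measure space_if_sets_F[OF N])
    qed
    show "?R \<subseteq> ?L"
    proof
      fix w assume "w \<in> ?R"
      then obtain x y where w: "w = (x, y)" "p (x + y - z) < 1"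
        by (cases w) (auto simp: sball_def)
      \<comment> \<open>Half of the slack: \<open>p (x + y - z) = 1 - 2 * e\<close>, so replacing
        \<open>x\<close> by a \<open>q\<close> at distance below \<open>r < e\<close> costs
        \<open>r\<close> and still leaves \<open>p (y - (z - q)) < 1 - r\<close>.\<close>
      define e where "e = (1 - p (x + y - z)) / 2"
      have e: "0 < e" "e < 1"
        using w seminorm_nonneg[OF sn, of "x + y - z"] by (auto simp: e_def)
      obtain r where r: "r \<in> \<rat>" "0 < r" "r < e"
        using Rats_dense_in_real[of 0 e] e by auto
      obtain q where q: "q \<in> Q" "p (x - q) < r" using Q(2)[OF r(2)] by blast
      have "p (y - (z - q)) \<le> p (x + y - z) + p (q - x)"
        using seminorm_add[OF sn, of "x + y - z" "q - x"] by (simp add: algebra_simps)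
      also have "\<dots> < 1 - r"
        using q r seminorm_diff_commute[OF sn, of x q] by (simp add: e_def field_simps)
      finally have "w \<in> sball p q r \<times> sball p (z - q) (1 - r)"
        using w q by (simp add: sball_def)
      moreover have "(q, r) \<in> I" using q r e by (simp add: I_def)
      ultimately show "w \<in> ?L" by blast
    qed
  qed
  finally show "(\<lambda>(x, y). x + y) -` sball p z 1 \<inter> space (N \<Otimes>\<^sub>M N) \<in> sets (N \<Otimes>\<^sub>M N)" .
qed

lemma measurable_linear_combination:
  assumes N: "sets N = \<F>"
  shows "(\<lambda>(x, y). a *\<^sub>R x + b *\<^sub>R y) \<in> measurable (N \<Otimes>\<^sub>M N) N"
proof -
  note [measurable] = measurable_scaleR[OF N]
  have "(\<lambda>w. (a *\<^sub>R fst w, b *\<^sub>R snd w)) \<in> measurable (N \<Otimes>\<^sub>M N) (N \<Otimes>\<^sub>M N)"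
    by measurable
  from measurable_compose[OF this measurable_add[OF N]] show ?thesis
    by (simp add: case_prod_unfold)
qed

lemma measurable_sum:
  assumes N: "sets N = \<F>" and f: "\<And>k. k \<in> J \<Longrightarrow> f k \<in> measurable K N"
  shows "(\<lambda>\<omega>. \<Sum>k\<in>J. f k \<omega>) \<in> measurable K N"
  using f
proof (induction J rule: infinite_finite_induct)
  case (insert k J)
  from insert have "(\<lambda>\<omega>. (f k \<omega>, \<Sum>k\<in>J. f k \<omega>)) \<in> measurable K (N \<Otimes>\<^sub>M N)"
    by (intro measurable_Pair) auto
  from measurable_compose[OF this measurable_add[OF N]] insert show ?case by simp
qed (simp_all add: space_if_sets_F[OF N])

end

section \<open>Supermultiplicative sequences of laws\<close>

text \<open>The sets \<open>A\<close> and \<open>A \<inter> B\<close> have the same trace on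
  \<open>D\<close>. This replaces restriction to \<open>D\<close>, which may fail to be
  measurable.\<close>

lemma carried_by_mono:
  assumes "finite_measure \<nu>" "carried_by \<nu> D" "A \<in> sets \<nu>" "B \<in> sets \<nu>" "A \<inter> D \<subseteq> B"
  shows "measure \<nu> A \<le> measure \<nu> B"
proof -
  have "A \<inter> D = (A \<inter> B) \<inter> D" using assms(5) by blast
  then have "measure \<nu> A = measure \<nu> (A \<inter> B)"
    using assms(2-4) unfolding carried_by_def by blast
  also have "\<dots> \<le> measure \<nu> B"
    using assms by (intro finite_measure.finite_measure_mono) auto
  finally show ?thesis .
qed

text \<open>If \<open>A\<close> and \<open>B\<close> have the same trace on \<open>D\<close>, the
  complement of \<open>A - B\<close> contains \<open>D\<close>. So it has full mass, and
  \<open>A - B\<close> is null.\<close>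

lemma carried_byI:
  assumes "prob_space \<nu>" "D \<subseteq> space \<nu>" and full: "\<And>A. A \<in> sets \<nu> \<Longrightarrow> D \<subseteq> A \<Longrightarrow> 1 \<le> measure \<nu> A"
  shows "carried_by \<nu> D"
proof -
  interpret prob_space \<nu> by fact
  have le: "measure \<nu> A \<le> measure \<nu> B" if "A \<in> sets \<nu>" "B \<in> sets \<nu>" "A \<inter> D = B \<inter> D" for A B
  proof -
    have "1 \<le> measure \<nu> (space \<nu> - (A - B))"
      using that assms(2) by (intro full) auto
    then have "measure \<nu> (A - B) = 0"
      using that prob_compl[of "A - B"] by (simp add: measure_le_0_iff)
    then show ?thesis
      using measure_Un_le[of "A - B" \<nu> B] finite_measure_mono[of A "(A - B) \<union> B"] that
      by simp
  qed
  show ?thesis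
    unfolding carried_by_def using le by (metis antisym)
qed

text \<open>The rectangle \<open>A \<times> B\<close> is known to be mapped into \<open>E\<close>
  only over \<open>D \<times> D\<close>, so the carriers are used one coordinate at a time. The
  measurable set \<open>G\<close> collects the points whose section has at least the mass of
  \<open>B\<close>; the carrier of \<open>K\<close> puts \<open>A \<inter> D\<close> into
  \<open>G\<close>, the carrier of \<open>N\<close> then compares \<open>A\<close> with
  \<open>G\<close>, and integrating the sections over \<open>G\<close> gives the product.\<close>

lemma measure_mult_le_distr_pair:
  assumes "prob_space N" "prob_space K" "carried_by N D" "carried_by K D"
    and T: "T \<in> measurable (N \<Otimes>\<^sub>M K) L"
    and sets: "A \<in> sets N" "B \<in> sets K" "E \<in> sets L"
    and TE: "\<And>a b. a \<in> A \<inter> D \<Longrightarrow> b \<in> B \<inter> D \<Longrightarrow> T (a, b) \<in> E"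
  shows "measure N A * measure K B \<le> measure (distr (N \<Otimes>\<^sub>M K) L T) E"
proof -
  interpret N: prob_space N by fact
  interpret K: prob_space K by fact
  interpret P: pair_prob_space N K ..
  let ?E = "T -` E \<inter> space (N \<Otimes>\<^sub>M K)"
  have E: "?E \<in> sets (N \<Otimes>\<^sub>M K)"
    using T sets(3) by (rule measurable_sets)
  define G where "G = {x \<in> space N. emeasure K B \<le> emeasure K (Pair x -` ?E)}"
  have [measurable]: "(\<lambda>x. emeasure K (Pair x -` ?E)) \<in> borel_measurable N"
    using E by (rule K.measurable_emeasure_Pair)
  have G: "G \<in> sets N"
    unfolding G_def by measurable
  have sub: "A \<inter> D \<subseteq> G"
  proof
    fix a assume a: "a \<in> A \<inter> D"
    then have sp: "a \<in> space N" using sets sets.sets_into_space by blast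
    have "B \<inter> D \<subseteq> Pair a -` ?E"
      using TE[OF a] sp sets.sets_into_space[OF sets(2)] by (auto simp: space_pair_measure)
    then have "measure K B \<le> measure K (Pair a -` ?E)"
      using assms(4) sets E by (intro carried_by_mono[of _ D] sets_Pair1) (auto intro: K.finite_measure_axioms)
    then show "a \<in> G"
      using sp by (simp add: G_def K.emeasure_eq_measure)
  qed
  have "measure N A \<le> measure N G"
    using assms(3) sets G sub by (intro carried_by_mono) (auto intro: N.finite_measure_axioms)
  then have "emeasure N A * emeasure K B \<le> emeasure N G * emeasure K B"
    by (intro mult_right_mono) (auto simp: N.emeasure_eq_measure)
  also have "\<dots> = (\<integral>\<^sup>+x. emeasure K B * indicator G x \<partial>N)"
    by (subst nn_integral_cmult_indicator[OF G]) (rule mult.commute)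
  also have "\<dots> \<le> (\<integral>\<^sup>+x. emeasure K (Pair x -` ?E) \<partial>N)"
    by (intro nn_integral_mono) (auto simp: G_def indicator_def)
  also have "\<dots> = emeasure (N \<Otimes>\<^sub>M K) ?E"
    using E by (rule K.emeasure_pair_measure_alt[symmetric])
  also have "\<dots> = emeasure (distr (N \<Otimes>\<^sub>M K) L T) E"
    using T sets(3) by (rule emeasure_distr[symmetric])
  finally have *: "emeasure N A * emeasure K B \<le> emeasure (distr (N \<Otimes>\<^sub>M K) L T) E" .
  interpret D: prob_space "distr (N \<Otimes>\<^sub>M K) L T"
    using T by (rule P.prob_space_distr)
  show ?thesis
    using * by (simp add: N.emeasure_eq_measure K.emeasure_eq_measure D.emeasure_eq_measure
        flip: ennreal_mult)
qed

text \<open>Otherwise the powers of \<open>b / c > 1\<close> would be bounded by \<open>M\<close>.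
  This later removes the size of a finite cover from an exponential estimate.\<close>

lemma le_if_power_le_const_mult_power:
  fixes b c M :: real
  assumes "0 \<le> b" "0 < c" and le: "\<And>k. 1 \<le> k \<Longrightarrow> b ^ k \<le> M * c ^ k"
  shows "b \<le> c"
proof (rule ccontr)
  assume "\<not> b \<le> c"
  then have q: "1 < b / c" using assms by simp
  then obtain n where "M < (b / c) ^ n" using real_arch_pow by blast
  also have "\<dots> \<le> (b / c) ^ Suc n" using q by (intro power_increasing) auto
  also have "\<dots> \<le> M" using le[of "Suc n"] assms(2) by (simp add: power_divide field_simps)
  finally show False by simp
qed

section \<open>Logarithmic rates as inequalities between real masses\<close>

lemma ext_ln_le_iff: "ext_ln p \<le> ereal b \<longleftrightarrow> p \<le> exp b"
proof (cases "p \<le> 0")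
  case True
  then show ?thesis using exp_gt_zero[of b] by (simp add: ext_ln_def del: exp_gt_zero)
next
  case False
  then show ?thesis using exp_le_cancel_iff[of "ln p" b] by (simp add: ext_ln_def del: exp_le_cancel_iff)
qed

lemma le_ext_ln_iff: "ereal b \<le> ext_ln p \<longleftrightarrow> exp b \<le> p"
proof (cases "p \<le> 0")
  case True
  then show ?thesis using exp_gt_zero[of b] by (simp add: ext_ln_def del: exp_gt_zero)
next
  case False
  then show ?thesis using exp_le_cancel_iff[of b "ln p"] by (simp add: ext_ln_def del: exp_le_cancel_iff)
qed

lemma inverse_mult_ereal_le_iff:
  assumes "0 < (c::real)"
  shows "ereal (1 / c) * y \<le> ereal a \<longleftrightarrow> y \<le> ereal (c * a)"
    and "ereal a \<le> ereal (1 / c) * y \<longleftrightarrow> ereal (c * a) \<le> y"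
  using assms by (cases y; simp add: field_simps)+

text \<open>For real \<open>a\<close> the comparison is one between real masses, so null sets with
  rate \<open>-\<infinity>\<close> need no separate treatment. At \<open>n = 0\<close> the factor
  \<open>1 / real n\<close> is 0, which is why \<open>n\<close> is at least 1.\<close>

lemma log_rate_le_iff: "1 \<le> n \<Longrightarrow> log_rate \<nu> C n \<le> ereal a \<longleftrightarrow> measure (\<nu> n) C \<le> exp (real n * a)"
  by (simp add: log_rate_def inverse_mult_ereal_le_iff ext_ln_le_iff)

lemma le_log_rate_iff: "1 \<le> n \<Longrightarrow> ereal a \<le> log_rate \<nu> C n \<longleftrightarrow> exp (real n * a) \<le> measure (\<nu> n) C"
  by (simp add: log_rate_def inverse_mult_ereal_le_iff le_ext_ln_iff)

text \<open>Isolates what the argument uses of a Cramer sequence: the law of a mean over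
  \<open>m + n\<close> terms is the image of a product of two laws. The random variables disappear,
  and \<open>\<nu> 1\<close> takes the place of \<open>\<mu>\<close>.\<close>

locale cramer_laws = measurable_lcs \<C>\<^sub>0 \<F> \<tau>
  for \<C>\<^sub>0 :: "'a::real_vector set set" and \<F> :: "'a set set" and \<tau> :: "'a topology" +
  fixes D :: "'a set" and \<nu> :: "nat \<Rightarrow> 'a measure"
  assumes convex_D: "convex D"
    and prob_nu: "1 \<le> n \<Longrightarrow> prob_space (\<nu> n)"
    and sets_nu: "sets (\<nu> n) = \<F>"
    and carried_1: "carried_by (\<nu> 1) D"
    and nu_add: "1 \<le> m \<Longrightarrow> 1 \<le> n \<Longrightarrow> \<nu> (m + n) = distr (\<nu> m \<Otimes>\<^sub>M \<nu> n) (\<nu> 1)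
      (\<lambda>(x, y). (real m / real (m + n)) *\<^sub>R x + (real n / real (m + n)) *\<^sub>R y)"
begin

interpretation F: sigma_algebra UNIV \<F> by (rule sigma_algebra_F)

section \<open>Inequalities between the laws for convex events\<close>

lemma space_nu: "space (\<nu> n) = UNIV"
  by (rule space_if_sets_F[OF sets_nu])

lemma measurable_combination:
  "(\<lambda>(x, y). a *\<^sub>R x + b *\<^sub>R y) \<in> measurable (\<nu> m \<Otimes>\<^sub>M \<nu> n) (\<nu> k)"
proof -
  have eq: "measurable (\<nu> m \<Otimes>\<^sub>M \<nu> n) (\<nu> k) = measurable (\<nu> 1 \<Otimes>\<^sub>M \<nu> 1) (\<nu> 1)"
    by (intro measurable_cong_sets sets_pair_measure_cong) (simp_all add: sets_nu)
  show ?thesis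
    unfolding eq by (rule measurable_linear_combination[OF sets_nu])
qed

text \<open>The carrier property is a hypothesis here because \<open>carried_nu\<close> is derived
  from this lemma by induction; \<open>measure_mult_le\<close> is the version for later use.\<close>

lemma measure_mult_le_if_carried:
  assumes mn: "1 \<le> m" "1 \<le> n" and carr: "carried_by (\<nu> m) D" "carried_by (\<nu> n) D"
    and F: "A \<in> \<F>" "B \<in> \<F>" "E \<in> \<F>"
    and E: "\<And>a b. a \<in> A \<inter> D \<Longrightarrow> b \<in> B \<inter> D \<Longrightarrow>
      (real m / real (m + n)) *\<^sub>R a + (real n / real (m + n)) *\<^sub>R b \<in> E"
  shows "measure (\<nu> m) A * measure (\<nu> n) B \<le> measure (\<nu> (m + n)) E"
  unfolding nu_add[OF mn]
  using prob_nu[OF mn(1)] prob_nu[OF mn(2)] carr F E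
  by (intro measure_mult_le_distr_pair measurable_combination) (auto simp: sets_nu)

lemma combination_in_convex:
  assumes "1 \<le> m" "1 \<le> n" "convex S" "a \<in> S" "b \<in> S"
  shows "(real m / real (m + n)) *\<^sub>R a + (real n / real (m + n)) *\<^sub>R b \<in> S"
  using assms by (intro convexD) (auto simp flip: add_divide_distrib)

text \<open>By convexity of \<open>D\<close>, combinations of points of \<open>D\<close> stay in
  every measurable \<open>A\<close> containing \<open>D\<close>. The product inequality with both
  factors equal to the whole space then gives \<open>A\<close> mass at least 1.\<close>

lemma carried_nu: "1 \<le> n \<Longrightarrow> carried_by (\<nu> n) D"
proof (induction n rule: nat_induct_at_least)
  case base
  show ?case by (rule carried_1)
next
  case (Suc n)
  show ?case
  proof (rule carried_byI)
    show "prob_space (\<nu> (Suc n))" by (rule prob_nu) simp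
    fix A assume A: "A \<in> sets (\<nu> (Suc n))" "D \<subseteq> A"
    have "measure (\<nu> n) UNIV * measure (\<nu> 1) UNIV \<le> measure (\<nu> (n + 1)) A"
      using A Suc carried_1 F.top sets_nu combination_in_convex[OF _ _ convex_D]
      by (intro measure_mult_le_if_carried) blast+
    then show "1 \<le> measure (\<nu> (Suc n)) A"
      using prob_space.prob_space[OF prob_nu[of 1]] prob_space.prob_space[OF prob_nu[of n]] Suc
      by (simp add: space_nu)
  qed (simp add: space_nu)
qed

lemma measure_mult_le:
  assumes "1 \<le> m" "1 \<le> n" "A \<in> \<F>" "B \<in> \<F>" "E \<in> \<F>"
    and "\<And>a b. a \<in> A \<inter> D \<Longrightarrow> b \<in> B \<inter> D \<Longrightarrow>
      (real m / real (m + n)) *\<^sub>R a + (real n / real (m + n)) *\<^sub>R b \<in> E"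
  shows "measure (\<nu> m) A * measure (\<nu> n) B \<le> measure (\<nu> (m + n)) E"
  using assms by (intro measure_mult_le_if_carried carried_nu)

lemma measure_mono_D:
  assumes "1 \<le> n" "A \<in> \<F>" "B \<in> \<F>" "A \<inter> D \<subseteq> B"
  shows "measure (\<nu> n) A \<le> measure (\<nu> n) B"
  using assms carried_nu prob_nu
  by (intro carried_by_mono[of _ D]) (auto simp: sets_nu prob_space_def)

text \<open>If the means of \<open>k\<close> blocks of length \<open>n\<close> all lie in a convex
  set, so does the overall mean; the blocks are split off one by one.\<close>

lemma measure_power_le:
  assumes n: "1 \<le> n" and C: "C \<in> \<F>" "convex (C \<inter> D)" and k: "1 \<le> k"
  shows "measure (\<nu> n) C ^ k \<le> measure (\<nu> (k * n)) C"
  using k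
proof (induction k rule: nat_induct_at_least)
  case (Suc k)
  have "measure (\<nu> n) C * measure (\<nu> n) C ^ k \<le> measure (\<nu> n) C * measure (\<nu> (k * n)) C"
    using Suc by (intro mult_left_mono) auto
  also have "\<dots> \<le> measure (\<nu> (n + k * n)) C"
  proof (rule measure_mult_le[OF n _ C(1) C(1) C(1)])
    show kn: "1 \<le> k * n" using n Suc by simp
    show "(real n / real (n + k * n)) *\<^sub>R a + (real (k * n) / real (n + k * n)) *\<^sub>R b \<in> C"
      if "a \<in> C \<inter> D" "b \<in> C \<inter> D" for a b
      using combination_in_convex[OF n kn C(2) that] by blast
  qed
  finally show ?case by simp
qed simp

lemma measure_nu_le_1: "1 \<le> n \<Longrightarrow> measure (\<nu> n) C \<le> 1"
  by (rule prob_space.prob_le_1[OF prob_nu])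

lemma log_rate_nonpos: "1 \<le> n \<Longrightarrow> log_rate \<nu> C n \<le> 0"
  using log_rate_le_iff[of n \<nu> C 0] measure_nu_le_1[of n C] by (simp add: zero_ereal_def)

section \<open>Lower bound for the liminf of the rate on a ball\<close>

lemma exists_half_mass_sball:
  assumes p: "p \<in> seminorms" and j: "1 \<le> j"
  shows "\<exists>R. 0 < R \<and> 1 / 2 \<le> measure (\<nu> j) (sball p 0 R)"
proof -
  interpret prob_space "\<nu> j" using j by (rule prob_nu)
  let ?B = "\<lambda>i. sball p 0 (real i + 1)"
  have "(\<Union>i. ?B i) = UNIV"
  proof -
    have "y \<in> (\<Union>i. ?B i)" for y
    proof -
      obtain i where "p y < real i" using reals_Archimedean2 by blast
      then show ?thesis by (auto simp: sball_def intro!: exI[of _ i])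
    qed
    then show ?thesis by blast
  qed
  moreover have "(\<lambda>i. measure (\<nu> j) (?B i)) \<longlonglongrightarrow> measure (\<nu> j) (\<Union>i. ?B i)"
    by (rule finite_Lim_measure_incseq)
      (use sball_in_F[OF p] in \<open>auto simp: sets_nu\<close>, auto simp: incseq_def sball_def)
  ultimately have "(\<lambda>i. measure (\<nu> j) (?B i)) \<longlonglongrightarrow> 1"
    using prob_space by (simp add: space_nu)
  then have "\<forall>\<^sub>F i in sequentially. 1 / 2 < measure (\<nu> j) (?B i)"
    by (rule order_tendstoD) simp
  then obtain i where "1 / 2 < measure (\<nu> j) (?B i)"
    using eventually_happens' sequentially_bot by blast
  then show ?thesis by (intro exI[of _ "real i + 1"]) simp
qed

text \<open>Continuity from below along smaller concentric balls. The gap between \<open>r\<close>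
  and 1 later absorbs the displacement caused by a remainder block.\<close>

lemma exists_smaller_sball:
  assumes p: "p \<in> seminorms" and n: "1 \<le> n" and b: "b < measure (\<nu> n) (sball p x 1)"
  shows "\<exists>r. 0 < r \<and> r < 1 \<and> b < measure (\<nu> n) (sball p x r)"
proof -
  interpret prob_space "\<nu> n" using n by (rule prob_nu)
  \<comment> \<open>The shift by 2 keeps every radius positive, also at
    \<open>i = 0\<close>.\<close>
  let ?B = "\<lambda>i. sball p x (1 - 1 / (real i + 2))"
  have "(\<Union>i. ?B i) = sball p x 1"
  proof
    show "sball p x 1 \<subseteq> (\<Union>i. ?B i)"
    proof
      fix y assume "y \<in> sball p x 1"
      then have y: "0 < 1 - p (y - x)" by (simp add: sball_def)
      then obtain i where i: "inverse (real (Suc i)) < 1 - p (y - x)" using reals_Archimedean by blast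
      have "1 / (real i + 2) \<le> inverse (real (Suc i))" by (simp add: field_simps)
      then show "y \<in> (\<Union>i. ?B i)" using i by (intro UN_I[of i]) (auto simp: sball_def)
    qed
    show "(\<Union>i. ?B i) \<subseteq> sball p x 1"
    proof
      fix y assume "y \<in> (\<Union>i. ?B i)"
      then obtain i where "p (y - x) < 1 - 1 / (real i + 2)" by (auto simp: sball_def)
      moreover have "0 < 1 / (real i + 2)" by simp
      ultimately show "y \<in> sball p x 1" unfolding sball_def mem_Collect_eq by linarith
    qed
  qed
  moreover have "(\<lambda>i. measure (\<nu> n) (?B i)) \<longlonglongrightarrow> measure (\<nu> n) (\<Union>i. ?B i)"
  proof (rule finite_Lim_measure_incseq)
    show "range ?B \<subseteq> sets (\<nu> n)" using sball_in_F[OF p] by (auto simp: sets_nu)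
    show "incseq ?B"
      unfolding incseq_def
    proof (intro allI impI)
      fix i j :: nat assume "i \<le> j"
      then have "1 / (real j + 2) \<le> 1 / (real i + 2)" by (simp add: frac_le)
      then show "?B i \<subseteq> ?B j" by (auto simp: sball_def)
    qed
  qed
  ultimately have "\<forall>\<^sub>F i in sequentially. b < measure (\<nu> n) (?B i)"
    using b by (intro order_tendstoD) auto
  then obtain i where "b < measure (\<nu> n) (?B i)"
    using eventually_happens' sequentially_bot by blast
  then show ?thesis by (intro exI[of _ "1 - 1 / (real i + 2)"]) (simp add: field_simps)
qed

text \<open>A single index \<open>n\<close> controls all large \<open>N = k * n + j\<close>. The
  \<open>k\<close> blocks of length \<open>n\<close> have their mean in a smaller ball with mass at
  least \<open>b ^ k\<close>, and the remaining \<open>j \<le> n\<close> terms have their mean in a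
  large ball of mass at least 1/2. The weight \<open>j / N\<close> of the remainder tends to 0, so
  the total mean stays in the unit ball around \<open>x\<close>, and the factor 1/2 vanishes on the
  exponential scale.\<close>

lemma liminf_sball_ge:
  assumes p: "p \<in> seminorms" and n: "1 \<le> n" and a: "exp (real n * a) < measure (\<nu> n) (sball p x 1)"
  shows "ereal a \<le> liminf (log_rate \<nu> (sball p x 1))"
proof -
  have sn: "seminorm p" using p by (rule seminorm_if_seminorms)
  obtain r where r: "0 < r" "r < 1" and b: "exp (real n * a) < measure (\<nu> n) (sball p x r)"
    using exists_smaller_sball[OF p n a] by blast
  define b where "b = measure (\<nu> n) (sball p x r)"
  \<comment> \<open>The rate attained on the smaller ball: \<open>b = exp (real n * a')\<close>. The
    strict gap \<open>a < a'\<close> pays for the factor 1/2.\<close>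
  define a' where "a' = ln b / real n"
  have b0: "0 < b" using b exp_gt_zero[of "real n * a"] unfolding b_def by linarith
  have b_eq: "b = exp (real n * a')" using n b0 by (simp add: a'_def)
  have aa': "a < a'" using b n unfolding b_def[symmetric] b_eq by simp
  have a'0: "a' \<le> 0" using measure_nu_le_1[OF n, of "sball p x r"] n b0
    by (simp add: a'_def b_def divide_nonpos_nonneg)
  obtain R where R: "\<And>j. 1 \<le> j \<Longrightarrow> 0 < R j \<and> 1 / 2 \<le> measure (\<nu> j) (sball p 0 (R j))"
    using exists_half_mass_sball[OF p] by metis
  \<comment> \<open>A sum of nonnegative radii serves as a common bound for all remainder lengths
    from 1 to \<open>n\<close>.\<close>
  define R' where "R' = (\<Sum>j=1..n. R j)"
  have R_le: "R j \<le> R'" if "1 \<le> j" "j \<le> n" for j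
    unfolding R'_def using that R by (intro member_le_sum) (auto intro: less_imp_le)
  have large: "\<forall>\<^sub>F N in sequentially. c < real N" for c
    using filterlim_real_sequentially by (simp add: filterlim_at_top_dense)
  have "\<forall>\<^sub>F N in sequentially. ereal a \<le> log_rate \<nu> (sball p x 1) N"
    \<comment> \<open>The three thresholds give, in this order: at least one full block, a
      displacement by the remainder below \<open>1 - r\<close>, and
      \<open>N * (a' - a) > ln 2\<close>.\<close>
    using eventually_gt_at_top[of n] large[of "real n * (R' + p x) / (1 - r)"] large[of "ln 2 / (a' - a)"]
  proof eventually_elim
    case (elim N)
    define k where "k = (N - 1) div n"
    define j where "j = (N - 1) mod n + 1" \<comment> \<open>the shift keeps \<open>j \<ge> 1\<close>, since nothing is assumed about the law \<open>\<nu> 0\<close>\<close>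
    have N: "N = k * n + j" using elim by (simp add: k_def j_def)
    have j: "1 \<le> j" "j \<le> n" using n by (auto simp: j_def Suc_le_eq)
    have k: "1 \<le> k" using elim n by (simp add: k_def Suc_le_eq div_greater_zero_iff)
    have kn: "1 \<le> k * n" using k n by simp
    have "b ^ k * (1 / 2) \<le> measure (\<nu> (k * n)) (sball p x r) * measure (\<nu> j) (sball p 0 (R j))"
    proof (rule mult_mono)
      have "convex (sball p x r \<inter> D)"
        using convex_sball[OF sn] convex_D by (rule convex_Int)
      from measure_power_le[OF n sball_in_F[OF p r(1)] this k]
      show "b ^ k \<le> measure (\<nu> (k * n)) (sball p x r)" by (simp add: b_def)
    qed (use R[OF j(1)] in auto)
    also have "\<dots> \<le> measure (\<nu> (k * n + j)) (sball p x 1)"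
    proof (rule measure_mult_le[OF kn j(1)])
      fix u v assume "u \<in> sball p x r \<inter> D" "v \<in> sball p 0 (R j) \<inter> D"
      then have uv: "p (u - x) < r" "p v < R j" by (auto simp: sball_def)
      define \<alpha> where "\<alpha> = real (k * n) / real (k * n + j)"
      define \<beta> where "\<beta> = real j / real (k * n + j)"
      have "\<alpha> + \<beta> = real (k * n + j) / real (k * n + j)"
        unfolding \<alpha>_def \<beta>_def add_divide_distrib[symmetric] by simp
      also have "\<dots> = 1" using j(1) by (intro divide_self) linarith
      finally have "\<alpha> + \<beta> = 1" .
      moreover have "0 \<le> \<alpha>" "0 \<le> \<beta>" by (auto simp: \<alpha>_def \<beta>_def)
      ultimately have ab: "0 \<le> \<alpha>" "\<alpha> \<le> 1" "0 \<le> \<beta>" "\<alpha> + \<beta> = 1" by auto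
      have "\<alpha> *\<^sub>R u + \<beta> *\<^sub>R v - x = \<alpha> *\<^sub>R (u - x) + \<beta> *\<^sub>R (v - x)"
      proof -
        have "x = \<alpha> *\<^sub>R x + \<beta> *\<^sub>R x" using ab by (simp flip: scaleR_add_left)
        then show ?thesis by (simp add: algebra_simps)
      qed
      then have "p (\<alpha> *\<^sub>R u + \<beta> *\<^sub>R v - x) \<le> \<alpha> * p (u - x) + \<beta> * p (v - x)"
        using seminorm_add[OF sn, of "\<alpha> *\<^sub>R (u - x)" "\<beta> *\<^sub>R (v - x)"] ab
        by (simp add: seminorm_scale[OF sn])
      also have "\<dots> \<le> 1 * r + (real n / real N) * (R' + p x)"
      proof (intro add_mono mult_mono)
        show "\<beta> \<le> real n / real N" using j by (simp add: \<beta>_def N divide_right_mono)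
        show "p (v - x) \<le> R' + p x"
          using seminorm_add[OF sn, of v "- x"] uv R_le[OF j] by (simp add: seminorm_uminus[OF sn])
      qed (use ab uv seminorm_nonneg[OF sn] r in auto)
      also have "\<dots> < 1"
        using elim r n by (simp add: field_simps)
      finally show "(real (k * n) / real (k * n + j)) *\<^sub>R u + (real j / real (k * n + j)) *\<^sub>R v \<in> sball p x 1"
        by (simp add: sball_def \<alpha>_def \<beta>_def)
    qed (use sball_in_F[OF p] r R[OF j(1)] in auto)
    finally have "b ^ k / 2 \<le> measure (\<nu> N) (sball p x 1)" by (simp add: N)
    moreover have "exp (real N * a) \<le> b ^ k / 2"
    proof -
      have "real N * a + ln 2 \<le> real N * a'"
        using elim aa' by (simp add: field_simps)
      \<comment> \<open>Since \<open>a' \<le> 0\<close>, shortening \<open>N\<close> to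
        \<open>k * n\<close> can only increase the product.\<close>
      also have "\<dots> \<le> real (k * n) * a'"
        using a'0 by (intro mult_right_mono_neg) (auto simp: N)
      finally have "exp (real N * a + ln 2) \<le> exp (real k * (real n * a'))"
        by (simp add: mult.assoc)
      then show ?thesis unfolding b_eq exp_add by (simp add: exp_of_nat_mult)
    qed
    ultimately show ?case
      using elim by (subst le_log_rate_iff) auto
  qed
  then show ?thesis by (rule Liminf_bounded)
qed

text \<open>Contrapositive of \<open>liminf_sball_ge\<close>: an asymptotic hypothesis yields a
  bound at every \<open>n \<ge> 1\<close>, which can be summed over a finite cover.\<close>

lemma measure_sball_le_if_liminf_less:
  assumes p: "p \<in> seminorms" and n: "1 \<le> n" and a: "liminf (log_rate \<nu> (sball p x 1)) < ereal a"
  shows "measure (\<nu> n) (sball p x 1) \<le> exp (real n * a)"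
  using liminf_sball_ge[OF p n, of a x] a by (meson not_le)

section \<open>The entropy as an infimum over seminorms\<close>

lemma entropy_eq: "entropy \<C>\<^sub>0 \<nu> x = (INF p\<in>seminorms. liminf (log_rate \<nu> (sball p x 1)))"
  by (simp add: entropy_def translates_eq image_image)

lemma entropy_nonpos: "entropy \<C>\<^sub>0 \<nu> x \<le> 0"
proof -
  obtain p where p: "p \<in> seminorms" using seminorms_nonempty by blast
  have "liminf (log_rate \<nu> (sball p x 1)) \<le> limsup (log_rate \<nu> (sball p x 1))"
    by (rule Liminf_le_Limsup) simp
  also have "\<dots> \<le> 0"
    using log_rate_nonpos by (intro Limsup_bounded eventually_sequentiallyI[of 1])
  finally show ?thesis
    unfolding entropy_eq using p by (rule INF_lower2[rotated])
qed

lemma eff_dom_eq: "eff_dom (entropy \<C>\<^sub>0 \<nu>) = {x. entropy \<C>\<^sub>0 \<nu> x \<noteq> - \<infinity>}"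
proof (intro set_eqI)
  show "x \<in> eff_dom (entropy \<C>\<^sub>0 \<nu>) \<longleftrightarrow> x \<in> {x. entropy \<C>\<^sub>0 \<nu> x \<noteq> - \<infinity>}" for x
    using entropy_nonpos[of x] by (cases "entropy \<C>\<^sub>0 \<nu> x") (auto simp: eff_dom_def)
qed

end

section \<open>Upper bound and domain of the entropy under convex tightness\<close>

locale cramer_laws_tight = cramer_laws +
  assumes tight: "convex_tight_on \<tau> (\<nu> 1) D"
begin

section \<open>Upper bound for convex events\<close>

lemma F_Int: "A \<in> \<F> \<Longrightarrow> B \<in> \<F> \<Longrightarrow> A \<inter> B \<in> \<F>"
  and F_Un: "A \<in> \<F> \<Longrightarrow> B \<in> \<F> \<Longrightarrow> A \<union> B \<in> \<F>"
  unfolding sets_nu[of 1, symmetric] by blast+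

lemma F_finite_Union: "finite G \<Longrightarrow> G \<subseteq> \<F> \<Longrightarrow> \<Union>G \<in> \<F>"
  unfolding sets_nu[of 1, symmetric] by (rule sets.finite_Union)

lemma measure_compact_le:
  assumes C: "C \<in> \<F>" "convex (C \<inter> D)" and L: "compactin \<tau> L" "C \<inter> D \<subseteq> L"
    and a: "\<And>x. x \<in> \<tau> closure_of C \<Longrightarrow> entropy \<C>\<^sub>0 \<nu> x < ereal a" and n: "1 \<le> n"
  shows "measure (\<nu> n) C \<le> exp (real n * a)"
proof -
  \<comment> \<open>Each ball of the cover obeys the bound for all \<open>N \<ge> 1\<close> at once,
    so one finite subcover serves every \<open>N\<close>.\<close>
  define G where "G = {sball p x 1 |p x. p \<in> seminorms \<and> (\<forall>N\<ge>1. measure (\<nu> N) (sball p x 1) \<le> exp (real N * a))}"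
  \<comment> \<open>The entropy is controlled on the closure of \<open>C\<close>, compactness is
    available on \<open>L\<close>; the intersection still contains \<open>C \<inter> D\<close>, the
    only part of \<open>C\<close> that the laws see.\<close>
  let ?Z = "\<tau> closure_of C \<inter> L"
  have "compactin \<tau> ?Z"
    using L(1) by (intro closed_Int_compactin) auto
  moreover have "\<forall>U\<in>G. openin \<tau> U"
    by (auto simp: G_def openin_sball)
  moreover have "?Z \<subseteq> \<Union>G"
  proof
    fix x assume "x \<in> ?Z"
    then obtain p where p: "p \<in> seminorms" "liminf (log_rate \<nu> (sball p x 1)) < ereal a"
      using a[of x] by (auto simp: entropy_eq INF_less_iff)
    then have "sball p x 1 \<in> G"
      unfolding G_def using measure_sball_le_if_liminf_less[OF p(1) _ p(2)] by blast
    then show "x \<in> \<Union>G"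
      using centre_in_sball[OF seminorm_if_seminorms[OF p(1)], of 1 x] by auto
  qed
  ultimately obtain G' where G': "finite G'" "G' \<subseteq> G" "?Z \<subseteq> \<Union>G'"
    unfolding compactin_def by meson
  have "G \<subseteq> \<F>" by (auto simp: G_def intro!: sball_in_F)
  then have F: "G' \<subseteq> \<F>" using G'(2) by blast
  have "C \<subseteq> \<tau> closure_of C"
    by (rule closure_of_subset) (simp add: topspace_UNIV)
  then have sub: "C \<inter> D \<subseteq> \<Union>G'"
    using L(2) G'(3) by blast
  have bound: "measure (\<nu> N) C \<le> real (card G') * exp (real N * a)" if N: "1 \<le> N" for N
  proof -
    have "measure (\<nu> N) C \<le> measure (\<nu> N) (\<Union>G')"
      using N C F_finite_Union[OF G'(1) F] sub by (intro measure_mono_D)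
    also have "\<dots> \<le> (\<Sum>U\<in>G'. measure (\<nu> N) U)"
      using G'(1) F by (intro measure_Union_le) (auto simp: sets_nu)
    also have "\<dots> \<le> real (card G') * exp (real N * a)"
      using G'(2) N by (intro sum_bounded_above) (auto simp: G_def)
    finally show ?thesis .
  qed
  \<comment> \<open>At the index \<open>k * n\<close> the bound has the same factor
    \<open>card G'\<close> for every \<open>k\<close>, so comparing \<open>k\<close>-th powers
    removes it.\<close>
  show ?thesis
  proof (rule le_if_power_le_const_mult_power[where M="real (card G')"])
    fix k :: nat assume k: "1 \<le> k"
    have "measure (\<nu> n) C ^ k \<le> measure (\<nu> (k * n)) C"
      by (rule measure_power_le[OF n C k])
    also have "\<dots> \<le> real (card G') * exp (real (k * n) * a)"
      using k n by (intro bound) simp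
    also have "exp (real (k * n) * a) = exp (real n * a) ^ k"
      by (simp add: exp_of_nat_mult[symmetric] mult.assoc)
    finally show "measure (\<nu> n) C ^ k \<le> real (card G') * exp (real n * a) ^ k" .
  qed auto
qed

lemma tightE:
  obtains K L :: "nat \<Rightarrow> 'a set" where "\<And>m. K m \<in> \<F>" "\<And>m. convex (K m \<inter> D)" "\<And>m. compactin \<tau> (L m)"
    "\<And>m. K m \<inter> D \<subseteq> L m" "(\<lambda>m. measure (\<nu> 1) (K m)) \<longlonglongrightarrow> 1"
  using tight unfolding convex_tight_on_def sets_nu by metis

text \<open>The compact case applies to \<open>C \<inter> K m\<close>, and the mass outside
  \<open>K m\<close> is at most \<open>1 - measure (\<nu> 1) (K m) ^ n\<close>. This tends to 0 as
  \<open>m\<close> grows with \<open>n\<close> fixed, so no tightness uniform in \<open>n\<close> is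
  involved.\<close>

lemma measure_le_exp_if_entropy_less:
  assumes C: "C \<in> \<F>" "convex (C \<inter> D)"
    and a: "\<And>x. x \<in> \<tau> closure_of C \<Longrightarrow> entropy \<C>\<^sub>0 \<nu> x < ereal a" and n: "1 \<le> n"
  shows "measure (\<nu> n) C \<le> exp (real n * a)"
proof -
  obtain K L :: "nat \<Rightarrow> 'a set" where K: "\<And>m. K m \<in> \<F>" "\<And>m. convex (K m \<inter> D)"
    and L: "\<And>m. compactin \<tau> (L m)" "\<And>m. K m \<inter> D \<subseteq> L m"
    and lim: "(\<lambda>m. measure (\<nu> 1) (K m)) \<longlonglongrightarrow> 1"
    using tightE by blast
  have "measure (\<nu> n) C \<le> exp (real n * a) + (1 - measure (\<nu> 1) (K m) ^ n)" for m
  proof -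
    have "measure (\<nu> 1) (K m) ^ n \<le> measure (\<nu> n) (K m)"
      using measure_power_le[of 1, OF _ K n] by simp
    also have "measure (\<nu> n) (K m) = 1 - measure (\<nu> n) (UNIV - K m)"
      using K(1)[of m] prob_space.prob_compl[OF prob_nu[OF n], of "K m"] by (simp add: sets_nu space_nu)
    finally have *: "measure (\<nu> n) (UNIV - K m) \<le> 1 - measure (\<nu> 1) (K m) ^ n"
      by simp
    have "UNIV - K m \<in> \<F>"
      using K(1)[of m] sets.compl_sets[of "K m" "\<nu> 1"] by (simp add: sets_nu space_nu)
    then have "measure (\<nu> n) ((C \<inter> K m) \<union> (UNIV - K m)) \<le> measure (\<nu> n) (C \<inter> K m) + measure (\<nu> n) (UNIV - K m)"
      using C K by (intro measure_Un_le) (auto simp: sets_nu F_Int)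
    moreover have "measure (\<nu> n) C \<le> measure (\<nu> n) ((C \<inter> K m) \<union> (UNIV - K m))"
      using \<open>UNIV - K m \<in> \<F>\<close> C K by (intro measure_mono_D n F_Un F_Int) auto
    moreover have "measure (\<nu> n) (C \<inter> K m) \<le> exp (real n * a)"
    proof (rule measure_compact_le[OF _ _ L(1)[of m] _ _ n])
      show "C \<inter> K m \<in> \<F>" using C K by (intro F_Int)
      have "convex ((C \<inter> D) \<inter> (K m \<inter> D))" using C(2) K(2) by (rule convex_Int)
      then show "convex (C \<inter> K m \<inter> D)" by (simp add: Int_ac)
      show "C \<inter> K m \<inter> D \<subseteq> L m" using L(2)[of m] by blast
      show "entropy \<C>\<^sub>0 \<nu> x < ereal a" if "x \<in> \<tau> closure_of (C \<inter> K m)" for x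
        using that closure_of_mono[of "C \<inter> K m" C \<tau>] by (intro a) auto
    qed
    ultimately show ?thesis using * by linarith
  qed
  moreover have "(\<lambda>m. exp (real n * a) + (1 - measure (\<nu> 1) (K m) ^ n)) \<longlonglongrightarrow> exp (real n * a) + (1 - 1 ^ n)"
    by (intro tendsto_intros lim)
  ultimately show ?thesis
    by (intro LIMSEQ_le_const[where X="\<lambda>m. exp (real n * a) + (1 - measure (\<nu> 1) (K m) ^ n)"]) auto
qed

theorem limsup_log_rate_le:
  assumes C: "C \<in> \<F>" "convex (C \<inter> D)"
  shows "limsup (log_rate \<nu> C) \<le> (SUP x\<in>\<tau> closure_of C. entropy \<C>\<^sub>0 \<nu> x)"
\<comment> \<open>Only real \<open>z\<close> needs an argument: \<open>\<infinity>\<close> bounds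
  everything, and \<open>-\<infinity>\<close> cannot lie strictly above the supremum.\<close>
proof (rule dense_ge)
  fix z assume z: "(SUP x\<in>\<tau> closure_of C. entropy \<C>\<^sub>0 \<nu> x) < z"
  show "limsup (log_rate \<nu> C) \<le> z"
  proof (cases z)
    case (real a)
    have "entropy \<C>\<^sub>0 \<nu> x < ereal a" if "x \<in> \<tau> closure_of C" for x
      using z real that by (meson SUP_upper le_less_trans)
    then have "log_rate \<nu> C n \<le> z" if "1 \<le> n" for n
      using measure_le_exp_if_entropy_less[OF C _ that] that real by (simp add: log_rate_le_iff)
    then show ?thesis
      by (intro Limsup_bounded eventually_sequentiallyI[of 1])
  qed (use z in auto)
qed

section \<open>The domain of the entropy and the closed convex hull of the support\<close>

lemma entropy_outside_cosupp:
  assumes x: "x \<notin> cosupp \<C>\<^sub>0 \<tau> (\<nu> 1)"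
  shows "entropy \<C>\<^sub>0 \<nu> x = - \<infinity>"
proof -
  obtain S where S: "convex S" "closedin \<tau> S" "supp \<C>\<^sub>0 (\<nu> 1) \<subseteq> S" "x \<notin> S"
    using x by (auto simp: cosupp_def hull_def)
  have "openin \<tau> (UNIV - S)"
    using S(2) by (simp add: closedin_def topspace_UNIV)
  then obtain p where p: "p \<in> seminorms" "sball p x 1 \<subseteq> UNIV - S"
    using S(4) unfolding openin_iff translates_eq by blast
  have sn: "seminorm p" using p(1) by (rule seminorm_if_seminorms)
  \<comment> \<open>A convex neighbourhood of \<open>S\<close> built from one seminorm, hence in
    \<open>\<F>\<close>, whereas \<open>S\<close> is only known to be closed. The radius 1/2 keeps
    \<open>U\<close> disjoint from the half-ball around \<open>x\<close>.\<close>
  define U where "U = {y. \<exists>c\<in>S. p (y - c) < 1 / 2}"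
  have U_sball: "\<exists>r>0. sball p y r \<subseteq> U" if y: "y \<in> U" for y
  proof -
    obtain c where c: "c \<in> S" "p (y - c) < 1 / 2" using y by (auto simp: U_def)
    have "sball p y (1 / 2 - p (y - c)) \<subseteq> U"
    proof
      fix z assume "z \<in> sball p y (1 / 2 - p (y - c))"
      then have "p (z - c) < 1 / 2"
        using seminorm_triangle[OF sn, of z c y] by (simp add: sball_def)
      then show "z \<in> U" using c by (auto simp: U_def)
    qed
    then show ?thesis using c by (intro exI[of _ "1 / 2 - p (y - c)"]) auto
  qed
  have UF: "U \<in> \<F>"
    using p(1) U_sball by (rule sball_open_in_F)
  have "openin \<tau> U"
    unfolding openin_iff using U_sball sball_in_translates[OF p(1)] by blast
  then have U_closed: "closedin \<tau> (UNIV - U)"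
    by (simp add: closedin_def topspace_UNIV double_diff)
  \<comment> \<open>Written as the Minkowski sum of \<open>S\<close> and a ball, \<open>U\<close> is
    visibly convex.\<close>
  have "U = (\<Union>c\<in>S. \<Union>v\<in>sball p 0 (1 / 2). {c + v})"
  proof -
    have "y \<in> (\<Union>c\<in>S. \<Union>v\<in>sball p 0 (1 / 2). {c + v})" if "c \<in> S" "p (y - c) < 1 / 2" for y c
      using that by (intro UN_I[of c] UN_I[of "y - c"]) (auto simp: sball_def)
    moreover have "c + v \<in> U" if "c \<in> S" "v \<in> sball p 0 (1 / 2)" for c v
      using that by (auto simp: U_def sball_def intro!: bexI[of _ c])
    ultimately show ?thesis by (auto simp: U_def)
  qed
  then have "convex U"
    using convex_sums[OF S(1) convex_sball[OF sn]] by simp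
  then have U_conv: "convex (U \<inter> D)"
    using convex_D by (rule convex_Int)
  have disj: "U \<inter> sball p x (1 / 2) = {}"
  proof -
    have False if "c \<in> S" "p (y - c) < 1 / 2" "p (y - x) < 1 / 2" for c y
    proof -
      have "p (c - x) < 1"
        using seminorm_triangle[OF sn, of c x y] seminorm_diff_commute[OF sn, of c y] that by simp
      then show False using p(2) that(1) by (auto simp: sball_def)
    qed
    then show ?thesis by (auto simp: U_def sball_def)
  qed
  obtain K L :: "nat \<Rightarrow> 'a set" where K: "\<And>m. K m \<in> \<F>" "\<And>m. convex (K m \<inter> D)"
    and L: "\<And>m. compactin \<tau> (L m)" "\<And>m. K m \<inter> D \<subseteq> L m"
    and lim: "(\<lambda>m. measure (\<nu> 1) (K m)) \<longlonglongrightarrow> 1"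
    using tightE by blast
  \<comment> \<open>The complement of \<open>U\<close> avoids the support, so each of its points has
    a null ball. Within \<open>L m\<close> finitely many null balls suffice by compactness; this is
    how tightness makes the complement of \<open>U\<close> null.\<close>
  have "measure (\<nu> 1) (K m) \<le> measure (\<nu> 1) U" for m
  proof -
    define G where "G = {sball p y 1 |p y. p \<in> seminorms \<and> measure (\<nu> 1) (sball p y 1) = 0}"
    have "compactin \<tau> ((UNIV - U) \<inter> L m)"
      using U_closed L(1) by (rule closed_Int_compactin)
    moreover have "\<forall>V\<in>G. openin \<tau> V"
      by (auto simp: G_def openin_sball)
    moreover have "(UNIV - U) \<inter> L m \<subseteq> \<Union>G"
    proof
      fix y assume "y \<in> (UNIV - U) \<inter> L m"
      then have "y \<notin> supp \<C>\<^sub>0 (\<nu> 1)"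
        using S(3) seminorm_zero[OF sn] by (force simp: U_def)
      then obtain q where q: "q \<in> seminorms" "\<not> 0 < measure (\<nu> 1) (sball q y 1)"
        unfolding supp_def translates_eq by blast
      then have "measure (\<nu> 1) (sball q y 1) = 0"
        by (meson measure_nonneg not_le order_antisym)
      with q(1) have "sball q y 1 \<in> G"
        unfolding G_def by blast
      then show "y \<in> \<Union>G"
        using centre_in_sball[OF seminorm_if_seminorms[OF q(1)], of 1 y] by auto
    qed
    ultimately obtain G' where G': "finite G'" "G' \<subseteq> G" "(UNIV - U) \<inter> L m \<subseteq> \<Union>G'"
      unfolding compactin_def by meson
    have "G \<subseteq> \<F>" by (auto simp: G_def intro!: sball_in_F)
  then have F: "G' \<subseteq> \<F>" using G'(2) by blast
    have "measure (\<nu> 1) (\<Union>G') \<le> (\<Sum>V\<in>G'. measure (\<nu> 1) V)"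
      using G'(1) F by (intro measure_Union_le) (auto simp: sets_nu)
    also have "\<dots> = 0"
      using G'(2) by (intro sum.neutral) (auto simp: G_def)
    finally have null: "measure (\<nu> 1) (\<Union>G') \<le> 0" .
    have "measure (\<nu> 1) (K m) \<le> measure (\<nu> 1) (U \<union> \<Union>G')"
      using K UF F_finite_Union[OF G'(1) F] L(2)[of m] G'(3)
      by (intro measure_mono_D F_Un) auto
    also have "\<dots> \<le> measure (\<nu> 1) U + measure (\<nu> 1) (\<Union>G')"
      using UF F_finite_Union[OF G'(1) F] by (intro measure_Un_le) (auto simp: sets_nu)
    finally show ?thesis using null by simp
  qed
  then have U1: "1 \<le> measure (\<nu> 1) U"
    using lim by (intro LIMSEQ_le_const2) auto
  have V_null: "log_rate \<nu> (sball p x (1 / 2)) n = - \<infinity>" if n: "1 \<le> n" for n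
  proof -
    interpret prob_space "\<nu> n" using n by (rule prob_nu)
    have VF: "sball p x (1 / 2) \<in> \<F>" using p(1) by (rule sball_in_F) simp
    \<comment> \<open>Full mass of the convex trace \<open>U \<inter> D\<close> passes from
      \<open>\<nu> 1\<close> to \<open>\<nu> n\<close>, which leaves nothing for the disjoint
      half-ball.\<close>
    have "1 \<le> measure (\<nu> 1) U ^ n" using U1 by (rule one_le_power)
    also have "\<dots> \<le> measure (\<nu> n) U"
      using measure_power_le[of 1, OF _ UF U_conv n] by simp
    finally have "measure (\<nu> n) (sball p x (1 / 2)) \<le> 0"
      using finite_measure_Union[of U "sball p x (1 / 2)"] disj UF VF
        measure_nu_le_1[OF n, of "U \<union> sball p x (1 / 2)"] by (simp add: sets_nu)
    then show ?thesis using n by (simp add: log_rate_def ext_ln_def)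
  qed
  have "liminf (log_rate \<nu> (sball p x (1 / 2))) = liminf (\<lambda>n. - \<infinity> :: ereal)"
    using V_null by (intro Liminf_eq eventually_sequentiallyI[of 1])
  also have "\<dots> = - \<infinity>" by (simp add: Liminf_const)
  finally have "entropy \<C>\<^sub>0 \<nu> x \<le> - \<infinity>"
    unfolding entropy_def using sball_in_translates[OF p(1), of "1 / 2" x] by (intro INF_lower2) auto
  then show ?thesis by simp
qed

text \<open>Of \<open>N\<close> terms, about \<open>u * N\<close> have their mean near
  \<open>x\<close> and the others near \<open>y\<close>, at a joint mass above
  \<open>exp (real N * a)\<close>. One such \<open>N\<close> per seminorm is enough, because
  \<open>liminf_sball_ge\<close> turns a strict bound at one index into a bound on the
  liminf.\<close>

lemma entropy_quasiconcave:
  assumes xy: "ereal a < entropy \<C>\<^sub>0 \<nu> x" "ereal a < entropy \<C>\<^sub>0 \<nu> y" and u: "0 < u" "u < 1"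
  shows "ereal a \<le> entropy \<C>\<^sub>0 \<nu> (u *\<^sub>R x + (1 - u) *\<^sub>R y)"
  unfolding entropy_eq
proof (rule INF_greatest)
  let ?z = "u *\<^sub>R x + (1 - u) *\<^sub>R y"
  fix p assume p: "p \<in> seminorms"
  then have sn: "seminorm p" by (rule seminorm_if_seminorms)
  have rate: "\<forall>\<^sub>F n in sequentially. ereal a < log_rate \<nu> (sball p w (1 / 2)) n"
    if "ereal a < entropy \<C>\<^sub>0 \<nu> w" for w
  proof (rule less_LiminfD)
    have "entropy \<C>\<^sub>0 \<nu> w \<le> liminf (log_rate \<nu> (sball p w (1 / 2)))"
      unfolding entropy_def using sball_in_translates[OF p] by (intro INF_lower) simp
    then show "ereal a < liminf (log_rate \<nu> (sball p w (1 / 2)))"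
      using that by simp
  qed
  have "\<forall>\<^sub>F n in sequentially. 1 \<le> n \<and> ereal a < log_rate \<nu> (sball p x (1 / 2)) n
      \<and> ereal a < log_rate \<nu> (sball p y (1 / 2)) n"
    using rate[OF xy(1)] rate[OF xy(2)] eventually_ge_at_top[of 1] by (simp add: eventually_conj_iff)
  then obtain n1 where n1: "\<And>n. n1 \<le> n \<Longrightarrow> 1 \<le> n \<and> ereal a < log_rate \<nu> (sball p x (1 / 2)) n
      \<and> ereal a < log_rate \<nu> (sball p y (1 / 2)) n"
    unfolding eventually_sequentially by blast
  have large: "\<forall>\<^sub>F N in sequentially. c < real N" for c
    using filterlim_real_sequentially by (simp add: filterlim_at_top_dense)
  \<comment> \<open>The first two conditions make both blocks at least \<open>n1\<close> long, the
    \<open>+ 1\<close> compensating for the floor in \<open>m\<close>; the third controls the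
    rounding error in the weights.\<close>
  have "\<forall>\<^sub>F N in sequentially. (n1 + 1) / u < real N \<and> (n1 + 1) / (1 - u) < real N \<and> 2 * p (x - y) < real N"
    using large by (simp add: eventually_conj_iff)
  then obtain N where "(n1 + 1) / u < real N" "(n1 + 1) / (1 - u) < real N" and N3: "2 * p (x - y) < real N"
    using eventually_happens' sequentially_bot by blast
  then have N: "real n1 + 1 < u * real N" "real n1 + 1 < (1 - u) * real N" "0 < real N"
    using u by (auto simp: field_simps)
  define m where "m = nat \<lfloor>u * real N\<rfloor>"
  have m: "real m \<le> u * real N" "u * real N < real m + 1"
    using u by (auto simp: m_def)
  have "u * real N \<le> real N" using u by (intro mult_left_le_one_le) auto
  then have "m \<le> N" using m by linarith
  define n where "n = N - m"
  have N_eq: "N = m + n" and n: "real n = real N - real m"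
    using \<open>m \<le> N\<close> by (auto simp: n_def)
  have "n1 \<le> m" using m N by linarith
  moreover have "n1 \<le> n" using m N n by (simp add: algebra_simps)
  ultimately have mn: "1 \<le> m" "ereal a < log_rate \<nu> (sball p x (1 / 2)) m"
    "1 \<le> n" "ereal a < log_rate \<nu> (sball p y (1 / 2)) n"
    using n1 by blast+
  have "exp (real N * a) = exp (real m * a) * exp (real n * a)"
    by (simp add: N_eq exp_add[symmetric] algebra_simps)
  also have "\<dots> < measure (\<nu> m) (sball p x (1 / 2)) * measure (\<nu> n) (sball p y (1 / 2))"
    using mn(2,4) unfolding not_le[symmetric] log_rate_le_iff[OF mn(1)] log_rate_le_iff[OF mn(3)]
    unfolding not_le by (intro mult_strict_mono') simp_all
  also have "\<dots> \<le> measure (\<nu> (m + n)) (sball p ?z 1)"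
  proof (rule measure_mult_le[OF mn(1,3)])
    fix v w assume "v \<in> sball p x (1 / 2) \<inter> D" "w \<in> sball p y (1 / 2) \<inter> D"
    then have vw: "p (v - x) < 1 / 2" "p (w - y) < 1 / 2" by (auto simp: sball_def)
    define \<alpha> where "\<alpha> = real m / real (m + n)"
    define \<beta> where "\<beta> = real n / real (m + n)"
    have \<beta>: "\<beta> = 1 - \<alpha>"
      using N(3) by (simp add: \<alpha>_def \<beta>_def N_eq field_simps)
    have \<alpha>: "0 \<le> \<alpha>" "\<alpha> \<le> 1"
      by (auto simp: \<alpha>_def divide_le_eq_1)
    \<comment> \<open>As \<open>m\<close> is the floor of \<open>u * N\<close>, the actual weight
      \<open>\<alpha> = m / N\<close> is within \<open>1 / N\<close> of \<open>u\<close>.\<close>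
    have "real N * \<bar>\<alpha> - u\<bar> \<le> 1"
    proof -
      have "real N * \<bar>\<alpha> - u\<bar> = \<bar>real N * \<alpha> - real N * u\<bar>"
        using N(3) by (simp add: abs_mult flip: right_diff_distrib)
      also have "real N * \<alpha> = real m" using N(3) by (simp add: \<alpha>_def N_eq)
      finally show ?thesis using m by (simp add: mult.commute)
    qed
    then have close: "\<bar>\<alpha> - u\<bar> * p (x - y) \<le> 1 / 2"
    proof -
      assume *: "real N * \<bar>\<alpha> - u\<bar> \<le> 1"
      have "\<bar>\<alpha> - u\<bar> * (2 * p (x - y)) \<le> \<bar>\<alpha> - u\<bar> * real N"
        using N3 by (intro mult_left_mono) auto
      then show ?thesis using * by (simp add: mult.commute)
    qed
    have "\<alpha> *\<^sub>R (v - x) + \<beta> *\<^sub>R (w - y) \<in> sball p 0 (1 / 2)"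
      using vw \<alpha> \<beta> by (intro convexD[OF convex_sball[OF sn]]) (auto simp: sball_def)
    then have near: "p (\<alpha> *\<^sub>R (v - x) + \<beta> *\<^sub>R (w - y)) < 1 / 2" by (simp add: sball_def)
    \<comment> \<open>The deviation splits into that of the block means, below 1/2, and that of the
      rounded weights, at most 1/2.\<close>
    have "\<alpha> *\<^sub>R v + \<beta> *\<^sub>R w - ?z = (\<alpha> *\<^sub>R (v - x) + \<beta> *\<^sub>R (w - y)) + (\<alpha> - u) *\<^sub>R (x - y)"
      by (simp add: \<beta> algebra_simps)
    also have "p \<dots> \<le> p (\<alpha> *\<^sub>R (v - x) + \<beta> *\<^sub>R (w - y)) + \<bar>\<alpha> - u\<bar> * p (x - y)"
      using seminorm_add[OF sn] by (simp add: seminorm_scale[OF sn, symmetric])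
    also have "\<dots> < 1" using near close by linarith
    finally show "(real m / real (m + n)) *\<^sub>R v + (real n / real (m + n)) *\<^sub>R w \<in> sball p ?z 1"
      by (simp add: sball_def \<alpha>_def \<beta>_def)
  qed (use sball_in_F[OF p] in auto)
  finally have "exp (real N * a) < measure (\<nu> N) (sball p ?z 1)" by (simp add: N_eq)
  moreover have "1 \<le> N" using mn N_eq by simp
  ultimately show "ereal a \<le> liminf (log_rate \<nu> (sball p ?z 1))"
    using liminf_sball_ge[OF p] by blast
qed

text \<open>The entropy is at most 0, so the domain is where it exceeds some real number, and
  quasiconcavity applies with a real \<open>a\<close> below both values. The end points of the
  segment are treated apart.\<close>

lemma convex_eff_dom: "convex (eff_dom (entropy \<C>\<^sub>0 \<nu>))"
  unfolding convex_alt
proof (intro ballI allI impI)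
  fix x y and u :: real
  assume x: "x \<in> eff_dom (entropy \<C>\<^sub>0 \<nu>)" and y: "y \<in> eff_dom (entropy \<C>\<^sub>0 \<nu>)" and u: "0 \<le> u \<and> u \<le> 1"
  have "- \<infinity> < min (entropy \<C>\<^sub>0 \<nu> x) (entropy \<C>\<^sub>0 \<nu> y)"
    using x y by (auto simp: eff_dom_eq)
  then obtain a where "ereal a < min (entropy \<C>\<^sub>0 \<nu> x) (entropy \<C>\<^sub>0 \<nu> y)"
    using ereal_dense2 by blast
  then have a: "ereal a < entropy \<C>\<^sub>0 \<nu> x" "ereal a < entropy \<C>\<^sub>0 \<nu> y" by auto
  consider "u = 0" | "u = 1" | "0 < 1 - u" "1 - u < 1" using u by fastforce
  then show "(1 - u) *\<^sub>R x + u *\<^sub>R y \<in> eff_dom (entropy \<C>\<^sub>0 \<nu>)"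
  proof cases
    case 3
    from entropy_quasiconcave[OF a 3] show ?thesis by (auto simp: eff_dom_eq)
  qed (use x y in auto)
qed

text \<open>The upper bound read backwards: if the entropy were below \<open>a\<close> on the
  closure of the half-ball around \<open>y\<close>, its mass would be at most \<open>exp a\<close>,
  which is chosen smaller than its actual mass.\<close>

lemma supp_subset_closure_eff_dom: "supp \<C>\<^sub>0 (\<nu> 1) \<subseteq> \<tau> closure_of (eff_dom (entropy \<C>\<^sub>0 \<nu>))"
proof
  fix y assume y: "y \<in> supp \<C>\<^sub>0 (\<nu> 1)"
  show "y \<in> \<tau> closure_of (eff_dom (entropy \<C>\<^sub>0 \<nu>))"
    unfolding in_closure_iff
  proof
    fix p assume p: "p \<in> seminorms"
    then have sn: "seminorm p" by (rule seminorm_if_seminorms)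
    let ?C = "sball p y (1 / 2)"
    have CF: "?C \<in> \<F>" using p by (rule sball_in_F) simp
    have conv: "convex (?C \<inter> D)"
      using convex_sball[OF sn] convex_D by (rule convex_Int)
    have pos: "0 < measure (\<nu> 1) ?C"
      using y sball_in_translates[OF p, of "1 / 2" y] by (simp add: supp_def)
    define a where "a = ln (measure (\<nu> 1) ?C) - 1"
    have "\<exists>z \<in> \<tau> closure_of ?C. ereal a \<le> entropy \<C>\<^sub>0 \<nu> z"
    proof (rule ccontr)
      assume "\<not> ?thesis"
      then have "measure (\<nu> 1) ?C \<le> exp (real 1 * a)"
        using CF conv by (intro measure_le_exp_if_entropy_less) (auto simp: not_le)
      then show False using pos by (simp add: a_def exp_diff field_simps)
    qed
    then obtain z where z: "z \<in> \<tau> closure_of ?C" "ereal a \<le> entropy \<C>\<^sub>0 \<nu> z" by blast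
    \<comment> \<open>The point \<open>z\<close> lies only in the closure of the half-ball; a point
      \<open>w\<close> of the half-ball within 1/2 of \<open>z\<close> shows that \<open>z\<close>
      is within 1 of \<open>y\<close>.\<close>
    have "(\<lambda>x. p x / (1 / 2)) \<in> seminorms" using p by (rule seminorms_divide) simp
    then have "sball (\<lambda>x. p x / (1 / 2)) z 1 \<inter> ?C \<noteq> {}" using z(1) unfolding in_closure_iff by blast
    then obtain w where w: "p (w - z) < 1 / 2" "p (w - y) < 1 / 2" by (auto simp: sball_def)
    have "p (z - y) < 1"
      using seminorm_triangle[OF sn, of z y w] seminorm_diff_commute[OF sn, of z w] w by simp
    then have "z \<in> sball p y 1" by (simp add: sball_def)
    moreover have "z \<in> eff_dom (entropy \<C>\<^sub>0 \<nu>)" using z(2) by (auto simp: eff_dom_eq)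
    ultimately show "sball p y 1 \<inter> eff_dom (entropy \<C>\<^sub>0 \<nu>) \<noteq> {}" by blast
  qed
qed

theorem closure_eff_dom: "\<tau> closure_of (eff_dom (entropy \<C>\<^sub>0 \<nu>)) = cosupp \<C>\<^sub>0 \<tau> (\<nu> 1)"
proof
  have "closedin \<tau> (cosupp \<C>\<^sub>0 \<tau> (\<nu> 1))"
    unfolding cosupp_def hull_def
  proof (rule closedin_Inter)
    have "closedin \<tau> UNIV" using closedin_topspace[of \<tau>] by (simp add: topspace_UNIV)
    then show "{t. (convex t \<and> closedin \<tau> t) \<and> supp \<C>\<^sub>0 (\<nu> 1) \<subseteq> t} \<noteq> {}" by blast
  qed auto
  moreover have "eff_dom (entropy \<C>\<^sub>0 \<nu>) \<subseteq> cosupp \<C>\<^sub>0 \<tau> (\<nu> 1)"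
    using entropy_outside_cosupp by (auto simp: eff_dom_eq)
  ultimately show "\<tau> closure_of (eff_dom (entropy \<C>\<^sub>0 \<nu>)) \<subseteq> cosupp \<C>\<^sub>0 \<tau> (\<nu> 1)"
    by (rule closure_of_minimal[rotated])
  show "cosupp \<C>\<^sub>0 \<tau> (\<nu> 1) \<subseteq> \<tau> closure_of (eff_dom (entropy \<C>\<^sub>0 \<nu>))"
    unfolding cosupp_def
    by (intro hull_minimal supp_subset_closure_eff_dom conjI convex_closure_of convex_eff_dom closedin_closure_of)
qed

end

section \<open>Cramer sequences\<close>

text \<open>Reduces laws of functions of a block to computations on a product space of copies of
  \<open>\<mu>\<close>, where blocks of equal length can be compared by reindexing.\<close>

lemma iid_distr_restrict:
  assumes iid: "iid_sequence M \<mu> X" and J: "J \<noteq> {}" "J \<subseteq> {1..}"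
  shows "distr M (PiM J (\<lambda>_. \<mu>)) (\<lambda>\<omega>. \<lambda>i\<in>J. X i \<omega>) = PiM J (\<lambda>_. \<mu>)"
proof -
  interpret prob_space M using iid by (simp add: iid_sequence_def)
  have ind: "indep_vars (\<lambda>_. \<mu>) X {1..}" and law: "\<And>n. 1 \<le> n \<Longrightarrow> distr M \<mu> (X n) = \<mu>"
    using iid by (auto simp: iid_sequence_def)
  have "indep_vars (\<lambda>_. \<mu>) X J"
    using ind J(2) by (rule indep_vars_subset)
  moreover from this have "X i \<in> measurable M \<mu>" if "i \<in> J" for i
    using that by (auto simp: indep_vars_def)
  ultimately have "distr M (PiM J (\<lambda>_. \<mu>)) (\<lambda>\<omega>. \<lambda>i\<in>J. X i \<omega>) = PiM J (\<lambda>i. distr M \<mu> (X i))"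
    using indep_vars_iff_distr_eq_PiM'[OF J(1), of X "\<lambda>_. \<mu>"] by simp
  also have "\<dots> = PiM J (\<lambda>_. \<mu>)"
    using J(2) law by (intro PiM_cong) auto
  finally show ?thesis .
qed

context measurable_lcs
begin

lemma measurable_scaled_sum:
  assumes "sets \<mu> = \<F>"
  shows "(\<lambda>x. c *\<^sub>R (\<Sum>k\<in>J. x k)) \<in> measurable (PiM J (\<lambda>_. \<mu>)) \<mu>"
  by (rule measurable_compose[OF measurable_sum[OF assms] measurable_scaleR[OF assms]])
    (rule measurable_component_singleton)

text \<open>The mean of \<open>m + n\<close> terms is the weighted combination of the mean
  \<open>A\<close> of the first \<open>m\<close> and the mean \<open>B\<close> of the next
  \<open>n\<close>. These depend on disjoint blocks, so their joint law is a product, and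
  \<open>B\<close> has law \<open>\<nu> n\<close> because shifting the indices by \<open>m\<close>
  preserves the product of identical factors.\<close>

lemma cramer_sequence_add:
  assumes sets: "sets \<mu> = \<F>" and \<mu>: "prob_space \<mu>" and iid: "iid_sequence M \<mu> X" and mn: "1 \<le> m" "1 \<le> n"
  defines "\<nu> \<equiv> cramer_sequence M \<mu> X"
  shows "\<nu> (m + n) = distr (\<nu> m \<Otimes>\<^sub>M \<nu> n) \<mu>
      (\<lambda>(x, y). (real m / real (m + n)) *\<^sub>R x + (real n / real (m + n)) *\<^sub>R y)"
proof -
  interpret prob_space M using iid by (simp add: iid_sequence_def)
  have ind: "indep_vars (\<lambda>_. \<mu>) X {1..}"
    using iid by (auto simp: iid_sequence_def)
  then have X: "X i \<in> measurable M \<mu>" if "1 \<le> i" for i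
    using that by (auto simp: indep_vars_def)
  let ?P = "\<lambda>J. PiM J (\<lambda>_. \<mu>)"
  let ?S = "\<lambda>c J x. c *\<^sub>R (\<Sum>k\<in>J. x k) :: 'a"
  let ?R = "\<lambda>J \<omega>. \<lambda>i\<in>J. X i \<omega>"
  define J where "J = {m + 1..m + n}"
  define A where "A = (\<lambda>\<omega>. ?S (1 / real m) {1..m} (\<lambda>i. X i \<omega>))"
  define B where "B = (\<lambda>\<omega>. ?S (1 / real n) J (\<lambda>i. X i \<omega>))"
  have R: "?R I \<in> measurable M (?P I)" if "I \<subseteq> {1..}" for I
    using that X by (intro measurable_restrict) auto
  note S = measurable_scaled_sum[OF sets]
  have indAB: "indep_var \<mu> A \<mu> B"
  proof -
    have "indep_var (?P {1..m}) (?R {1..m}) (?P J) (?R J)"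
      by (rule indep_var_restrict[OF ind]) (auto simp: J_def)
    from indep_var_compose[OF this S S, of "1 / real m" "1 / real n"] show ?thesis
      by (simp add: A_def B_def comp_def)
  qed
  have law: "distr M \<mu> (\<lambda>\<omega>. ?S c I (\<lambda>i. X i \<omega>)) = distr (?P I) \<mu> (?S c I)"
    if I: "I \<noteq> {}" "I \<subseteq> {1..}" for c I
  proof -
    have "distr (?P I) \<mu> (?S c I) = distr (distr M (?P I) (?R I)) \<mu> (?S c I)"
      by (simp only: iid_distr_restrict[OF iid I])
    also have "\<dots> = distr M \<mu> (?S c I \<circ> ?R I)"
      by (rule distr_distr[OF S R[OF I(2)]])
    finally show ?thesis by (simp add: comp_def)
  qed
  have nu_m: "distr M \<mu> A = \<nu> m"
    by (simp add: A_def \<nu>_def cramer_sequence_def)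
  have nu_n: "distr M \<mu> B = \<nu> n"
  proof -
    let ?f = "\<lambda>x. \<lambda>i\<in>{1..n}. x (m + i)"
    have "\<nu> n = distr (?P {1..n}) \<mu> (?S (1 / real n) {1..n})"
      unfolding \<nu>_def cramer_sequence_def by (rule law) (use mn in auto)
    also have "?P {1..n} = distr (?P J) (?P {1..n}) ?f"
      using \<mu> by (intro distr_PiM_reindex[symmetric]) (auto simp: J_def inj_on_def)
    also have "distr (distr (?P J) (?P {1..n}) ?f) \<mu> (?S (1 / real n) {1..n})
        = distr (?P J) \<mu> (?S (1 / real n) {1..n} \<circ> ?f)"
    proof (rule distr_distr[OF S])
      show "?f \<in> measurable (?P J) (?P {1..n})"
        by (intro measurable_restrict measurable_component_singleton) (auto simp: J_def)
    qed
    also have "?S (1 / real n) {1..n} \<circ> ?f = ?S (1 / real n) J"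
    proof
      fix x :: "nat \<Rightarrow> 'a"
      have "(\<Sum>k\<in>J. x k) = (\<Sum>k=1..n. x (m + k))"
        unfolding J_def by (rule sum.reindex_bij_witness[of _ "\<lambda>i. m + i" "\<lambda>i. i - m"]) auto
      then show "(?S (1 / real n) {1..n} \<circ> ?f) x = ?S (1 / real n) J x" by simp
    qed
    also have "distr (?P J) \<mu> (?S (1 / real n) J) = distr M \<mu> B"
      unfolding B_def by (rule law[symmetric]) (use mn in \<open>auto simp: J_def\<close>)
    finally show ?thesis by simp
  qed
  let ?T = "\<lambda>(x, y). (real m / real (m + n)) *\<^sub>R x + (real n / real (m + n)) *\<^sub>R y :: 'a"
  have AB: "A \<in> measurable M \<mu>" "B \<in> measurable M \<mu>"
    and prod: "distr M \<mu> A \<Otimes>\<^sub>M distr M \<mu> B = distr M (\<mu> \<Otimes>\<^sub>M \<mu>) (\<lambda>\<omega>. (A \<omega>, B \<omega>))"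
    using indAB unfolding indep_var_distribution_eq by auto
  have T: "?T \<in> measurable (\<mu> \<Otimes>\<^sub>M \<mu>) \<mu>"
    by (rule measurable_linear_combination[OF sets])
  have "distr (\<nu> m \<Otimes>\<^sub>M \<nu> n) \<mu> ?T = distr M \<mu> (?T \<circ> (\<lambda>\<omega>. (A \<omega>, B \<omega>)))"
    unfolding nu_m[symmetric] nu_n[symmetric] prod using AB by (intro distr_distr[OF T] measurable_Pair)
  also have "?T \<circ> (\<lambda>\<omega>. (A \<omega>, B \<omega>)) = (\<lambda>\<omega>. (1 / real (m + n)) *\<^sub>R (\<Sum>k=1..m + n. X k \<omega>))"
  proof
    fix \<omega>
    have "(\<Sum>k=1..m + n. X k \<omega>) = (\<Sum>k=1..m. X k \<omega>) + (\<Sum>k\<in>J. X k \<omega>)"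
      unfolding J_def by (rule sum.ub_add_nat) simp
    then show "(?T \<circ> (\<lambda>\<omega>. (A \<omega>, B \<omega>))) \<omega> = (1 / real (m + n)) *\<^sub>R (\<Sum>k=1..m + n. X k \<omega>)"
      using mn by (simp add: A_def B_def scaleR_add_right)
  qed
  finally show ?thesis by (simp add: \<nu>_def cramer_sequence_def)
qed

lemma cramer_sequence_1: "iid_sequence M \<mu> X \<Longrightarrow> cramer_sequence M \<mu> X 1 = \<mu>"
  by (simp add: cramer_sequence_def iid_sequence_def)

lemma cramer_laws_cramer_sequence:
  assumes sets: "sets \<mu> = \<F>" and \<mu>: "prob_space \<mu>" and iid: "iid_sequence M \<mu> X"
    and "convex D" "carried_by \<mu> D"
  shows "cramer_laws \<C>\<^sub>0 \<F> \<tau> D (cramer_sequence M \<mu> X)"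
proof (intro cramer_laws.intro measurable_lcs_axioms cramer_laws_axioms.intro)
  show "prob_space (cramer_sequence M \<mu> X n)" if "1 \<le> n" for n
  proof -
    have "X k \<in> measurable M \<mu>" if "1 \<le> k" for k
      using iid that by (auto simp: iid_sequence_def prob_space.indep_vars_def)
    then have "(\<lambda>\<omega>. (1 / real n) *\<^sub>R (\<Sum>k=1..n. X k \<omega>)) \<in> measurable M \<mu>"
      by (intro measurable_compose[OF measurable_sum[OF sets] measurable_scaleR[OF sets]]) auto
    then show ?thesis
      unfolding cramer_sequence_def using iid
      by (intro prob_space.prob_space_distr) (simp_all add: iid_sequence_def)
  qed
  show "sets (cramer_sequence M \<mu> X n) = \<F>" for n
    by (simp add: cramer_sequence_def sets)
  show "cramer_sequence M \<mu> X (m + n) = distr (cramer_sequence M \<mu> X m \<Otimes>\<^sub>M cramer_sequence M \<mu> X n)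
      (cramer_sequence M \<mu> X 1) (\<lambda>(x, y). (real m / real (m + n)) *\<^sub>R x + (real n / real (m + n)) *\<^sub>R y)"
    if "1 \<le> m" "1 \<le> n" for m n
    unfolding cramer_sequence_1[OF iid] by (rule cramer_sequence_add[OF sets \<mu> iid that])
  show "carried_by (cramer_sequence M \<mu> X 1) D"
    unfolding cramer_sequence_1[OF iid] by fact
qed fact

end

theorem mainTheorem2:
  fixes \<C>\<^sub>0 :: "'a::real_vector set set" and \<F> :: "'a set set" and \<tau> :: "'a topology"
    and D :: "'a set" and \<mu> :: "'a measure"
    and M :: "'w measure" and X :: "nat \<Rightarrow> 'w \<Rightarrow> 'a"
    and \<mu>s :: "nat \<Rightarrow> 'a measure" and s :: "'a \<Rightarrow> ereal"
  assumes "measurable_lcs \<C>\<^sub>0 \<F> \<tau>"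
    and "convex D"
    and "prob_space \<mu>" and "sets \<mu> = \<F>"
    and "carried_by \<mu> D"
    and "iid_sequence M \<mu> X"
    and "\<mu>s = cramer_sequence M \<mu> X"
    and "s = entropy \<C>\<^sub>0 \<mu>s"
    and "convex_tight_on \<tau> \<mu> D"
  shows "(\<forall>C\<in>\<F>. convex (C \<inter> D) \<longrightarrow>
            limsup (log_rate \<mu>s C) \<le> (SUP x\<in>\<tau> closure_of C. s x))
       \<and> \<tau> closure_of (eff_dom s) = cosupp \<C>\<^sub>0 \<tau> \<mu>"
proof -
  interpret measurable_lcs \<C>\<^sub>0 \<F> \<tau> by fact
  have first: "\<mu>s 1 = \<mu>"
    using assms by (simp only: cramer_sequence_1)
  interpret cramer_laws \<C>\<^sub>0 \<F> \<tau> D \<mu>s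
    using assms cramer_laws_cramer_sequence by simp
  interpret cramer_laws_tight \<C>\<^sub>0 \<F> \<tau> D \<mu>s
    by unfold_locales (use assms first in simp)
  show ?thesis
    using limsup_log_rate_le closure_eff_dom assms first by simp
qed

end
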